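(* Let $\lambda=\lim_n\lambda_n$, $\mathbf{v}=\lim_n \mathbf{v}_n$ (limit in $\ell^1$) and $\mathbf{w}=\lim_n\mathbf{w}_n$ (limit in $\ell^\infty$) be the limits of the maximum eigenvalues and of the normalised right and left eigenvectors of the truncations $\mathbf{A}_n$ described in the context, and let $\zeta=\mathbf{w}\mathbf{v}=\sum_{i\ge0}\mathbf{w}_i\mathbf{v}_i$. If $\mathbf{u}\in\ell^1$ satisfies $\mathbf{w}\mathbf{u}=\sum_{i\ge 0}\mathbf{w}_i\mathbf{u}_i\ne0$, then, with convergence in $\ell^1$, $$\lim_{n\to\infty}\lambda^{-n}\mathbf{A}^n\mathbf{u}=\frac{(\mathbf{w}\mathbf{u})\,\mathbf{v}}{\zeta}$$ and also $$\lim_{n\to\infty}\frac{\mathbf{A}^n\mathbf{u}}{\|\mathbf{A}^n\mathbf{u}\|}=\frac{(\mathbf{w}\mathbf{u})\,\mathbf{v}}{\|(\mathbf{w}\mathbf{u})\,\mathbf{v}\|},$$ where $\|\cdot\|$ is the $\ell^1$ norm.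
   Context: The infinite real matrix $\mathbf{A}=(\mathbf{A}_{ij})_{i,j\ge 0}$ has the following entries, where $r,k\ge 1$ are integers and $\binom kr=0$ for $k<r$: $\mathbf{A}_{0,0}=\tfrac12$, $\mathbf{A}_{0,1}=-1$, $\mathbf{A}_{0,j}=0$ for $j\ge 2$; $\mathbf{A}_{1,0}=\tfrac{\pi^2}{12}+\sum_{k\ge1}\tfrac{(-1)^k}{k^2 2^k}-\tfrac{\log 2}{2}$, $\mathbf{A}_{1,1}=\tfrac12+\log 2$, $\mathbf{A}_{1,k+1}=\tfrac1k+\tfrac{(-1)^k}{2^{k+1}}-\tfrac1{k2^k}$; $\mathbf{A}_{r+1,0}=\tfrac{(-1)^r}{r}\sum_{j=r}^\infty \tfrac1{j3^j}$, $\mathbf{A}_{r+1,1}=0$, $\mathbf{A}_{r+1,k+1}=\binom kr\left(\tfrac{(-1)^{k-r}}{2^{k+1}}-\tfrac1{k2^k}\right)$. $\mathbf{A}$ acts as a bounded operator on $\ell^1$ (sequences indexed by $0,1,2,\dots$). $\mathbf{A}_n$ denotes the $(n+1)\times(n+1)$ principal submatrix of $\mathbf{A}$ with row and column indices $0,\dots,n$. For $n\ge7$, $\mathbf{A}_n$ has a unique eigenvalue $\lambda_n$ of maximum absolute value, which is real and simple; $\mathbf{v}_n$ (column) and $\mathbf{w}_n$ (row) are the corresponding right and left eigenvectors, $\mathbf{A}_n\mathbf{v}_n=\lambda_n\mathbf{v}_n$, $\mathbf{w}_n\mathbf{A}_n=\lambda_n\mathbf{w}_n$, normalised by $(\mathbf{v}_n)_0=(\mathbf{w}_n)_0=1$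 and extended by zeros to infinite sequences. The sequence $\{\lambda_n\}$ converges, $\{\mathbf{v}_n\}$ converges in $\ell^1$ and $\{\mathbf{w}_n\}$ converges in $\ell^\infty$. *)

theory Defs
  imports Complex_Main "Jordan_Normal_Form.Char_Poly"
begin

(* The rows and columns from 2 on are parametrised by r = i - 1 >= 1 and k = j - 1 >= 1.
   Infinite sums over k >= 1 and j >= r are reindexed to start at 0.  In the last entry the
   truncated subtraction k - r only matters when k < r, where the binomial coefficient is 0. *)
definition Amat :: "nat \<Rightarrow> nat \<Rightarrow> real" where
  "Amat i j =
    (if i = 0 then
       (if j = 0 then 1 / 2 else if j = 1 then - 1 else 0)
     else if i = 1 then
       (if j = 0 then
          pi ^ 2 / 12 + (\<Sum>m. (- 1) ^ (m + 1) / (real (m + 1) ^ 2 * 2 ^ (m + 1))) - ln 2 / 2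
        else if j = 1 then 1 / 2 + ln 2
        else let k = j - 1 in
          1 / real k + (- 1) ^ k / 2 ^ (k + 1) - 1 / (real k * 2 ^ k))
     else let r = i - 1 in
       (if j = 0 then
          (- 1) ^ r / real r * (\<Sum>m. 1 / (real (r + m) * 3 ^ (r + m)))
        else if j = 1 then 0
        else let k = j - 1 in
          real (k choose r) * ((- 1) ^ (k - r) / 2 ^ (k + 1) - 1 / (real k * 2 ^ k))))"

definition A_op :: "(nat \<Rightarrow> real) \<Rightarrow> (nat \<Rightarrow> real)" where
  "A_op u = (\<lambda>i. \<Sum>j. Amat i j * u j)"

definition A_trunc :: "nat \<Rightarrow> real mat" where
  "A_trunc n = mat (n + 1) (n + 1) (\<lambda>(i, j). Amat i j)"

(* The competing eigenvalues range over the complex spectrum; simplicity is algebraic. *)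
definition simple_dominant_eigenvalue :: "real mat \<Rightarrow> real \<Rightarrow> bool" where
  "simple_dominant_eigenvalue M l \<longleftrightarrow>
    (let C = map_mat complex_of_real M in
       eigenvalue C (complex_of_real l) \<and>
       (\<forall>\<mu>. eigenvalue C \<mu> \<and> \<mu> \<noteq> complex_of_real l \<longrightarrow> cmod \<mu> < \<bar>l\<bar>) \<and>
       Polynomial.order (complex_of_real l) (char_poly C) = 1)"

definition ell1 :: "(nat \<Rightarrow> real) set" where
  "ell1 = {x. summable (\<lambda>i. \<bar>x i\<bar>)}"

definition norm1 :: "(nat \<Rightarrow> real) \<Rightarrow> real" where
  "norm1 x = (\<Sum>i. \<bar>x i\<bar>)"

definition ell_inf :: "(nat \<Rightarrow> real) set" where
  "ell_inf = {x. bdd_above (range (\<lambda>i. \<bar>x i\<bar>))}"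

definition norm_inf :: "(nat \<Rightarrow> real) \<Rightarrow> real" where
  "norm_inf x = (SUP i. \<bar>x i\<bar>)"

(* Membership is required explicitly because norm1 and norm_inf are unspecified
   outside the respective spaces. *)
definition tendsto_ell1 :: "(nat \<Rightarrow> nat \<Rightarrow> real) \<Rightarrow> (nat \<Rightarrow> real) \<Rightarrow> bool" where
  "tendsto_ell1 X L \<longleftrightarrow>
    L \<in> ell1 \<and> (\<forall>\<^sub>F n in sequentially. X n \<in> ell1) \<and>
    (\<lambda>n. norm1 (\<lambda>i. X n i - L i)) \<longlonglongrightarrow> 0"

definition tendsto_ell_inf :: "(nat \<Rightarrow> nat \<Rightarrow> real) \<Rightarrow> (nat \<Rightarrow> real) \<Rightarrow> bool" where
  "tendsto_ell_inf X L \<longleftrightarrow>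
    L \<in> ell_inf \<and> (\<forall>\<^sub>F n in sequentially. X n \<in> ell_inf) \<and>
    (\<lambda>n. norm_inf (\<lambda>i. X n i - L i)) \<longlonglongrightarrow> 0"

definition pairing :: "(nat \<Rightarrow> real) \<Rightarrow> (nat \<Rightarrow> real) \<Rightarrow> real" where
  "pairing w u = (\<Sum>i. w i * u i)"

end

theory Submission
  imports Defs "Jordan_Normal_Form.Spectral_Radius"
begin

text \<open>The limits satisfy \<open>w A = lam w\<close> and \<open>A v = lam v\<close>, so \<open>A\<close> preserves the kernel of \<open>w\<close>,
  and it suffices that \<open>A\<close> grows on that kernel at a rate strictly below \<open>lam\<close> (numerically
  \<open>lam = 1.2329\<close>). The pivot is index 1: column 1 is supported in rows 0 and 1, and its diagonal
  entry \<open>1/2 + ln 2\<close> exceeds the absolute sums of all other columns. The row action of every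
  truncation with at least four rows preserves a cone of row vectors dominated by coordinate 1
  and multiplies that coordinate by at least
  \<open>1/2 + ln 2\<close>; the dominant eigenvalue bounds the growth of matrix powers, so
  \<open>\<bar>lam\<bar> \<ge> 1/2 + ln 2\<close>. The eigenvector equation then bounds all coordinates of \<open>w\<close> by multiples
  of \<open>w\<^sub>1\<close>. Eliminating \<open>x\<^sub>1\<close> by \<open>w x = 0\<close>, the norm
  \<open>4/5 \<bar>x\<^sub>0\<bar> + (\<Sum>i\<ge>2. \<bar>x\<^sub>i\<bar>)\<close> grows at most by the factor \<open>11/10\<close> on the kernel. The same
  estimates give \<open>w v > 0\<close>, which fixes the sign of the normalised limit.\<close>

section \<open>Entries and column sums\<close>

text \<open>A geometric majorant for the terms from index \<open>N\<close> on sums to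
  \<open>c / (1 - q)\<close>. This replaces the series in column 0 by finite sums with an explicit
  error.\<close>

lemma suminf_partial_sum_error:
  fixes f :: "nat \<Rightarrow> real"
  assumes bound: "\<And>m. \<bar>f (m + N)\<bar> \<le> c * q ^ m" and q: "0 \<le> q" "q < 1"
  shows "summable f" "\<bar>suminf f - sum f {..<N}\<bar> \<le> c / (1 - q)"
proof -
  have geo: "(\<lambda>m. c * q ^ m) sums (c / (1 - q))"
    using sums_mult[OF geometric_sums, of q c] q by simp
  have "summable (\<lambda>m. \<bar>f (m + N)\<bar>)"
    by (rule summable_comparison_test'[OF sums_summable[OF geo], of 0]) (use bound in auto)
  then show f: "summable f"
    using summable_rabs_cancel summable_iff_shift by blast
  have "\<bar>\<Sum>m. f (m + N)\<bar> \<le> (\<Sum>m. \<bar>f (m + N)\<bar>)"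
    by (rule summable_rabs) fact
  also have "\<dots> \<le> c / (1 - q)"
    using suminf_le[OF bound \<open>summable (\<lambda>m. \<bar>f (m + N)\<bar>)\<close> sums_summable[OF geo]] sums_unique[OF geo]
    by simp
  finally show "\<bar>suminf f - sum f {..<N}\<bar> \<le> c / (1 - q)"
    using suminf_split_initial_segment[OF f, of N] by simp
qed

section \<open>Rational enclosures of \<open>ln 2\<close> and \<open>pi\<close>\<close>

lemma ln_2_bounds: "(173 / 250) \<le> ln (2::real)" "ln (2::real) \<le> (7 / 10)"
proof -
  \<comment> \<open>Expanding at a negative point with even order makes the remainder nonnegative,
    and a lower bound for \<open>exp (- x)\<close> is an upper bound for \<open>exp x\<close>; so no
    remainder has to be estimated from above.\<close>
  obtain s :: real where "exp (- (173 / 250)) = (\<Sum>m<6. (- (173 / 250)) ^ m / fact m) + exp s / fact 6 * (- (173 / 250)) ^ 6"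
    using Maclaurin_exp_le[of "- (173 / 250)" 6] by blast
  moreover have "0 \<le> exp s / fact 6 * (- (173 / 250)) ^ 6"
    by simp
  moreover have "(\<Sum>m<6. (- (173 / 250)) ^ m / fact m) \<ge> (1 / 2 :: real)"
    by (simp add: lessThan_nat_numeral fact_numeral power_divide)
  ultimately have "1 / 2 \<le> exp (- (173 / 250) :: real)"
    by linarith
  then have "exp ((173 / 250) :: real) \<le> 2"
    by (simp add: exp_minus field_simps)
  then show "(173 / 250) \<le> ln (2::real)"
    by (subst ln_ge_iff) auto
  obtain t :: real where "exp (7 / 10) = (\<Sum>m<4. (7 / 10) ^ m / fact m) + exp t / fact 4 * (7 / 10) ^ 4"
    using Maclaurin_exp_le[of "(7 / 10)" 4] by blast
  moreover have "0 \<le> exp t / fact 4 * (7 / 10) ^ 4"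
    by simp
  moreover have "(\<Sum>m<4. (7 / 10) ^ m / fact m) \<ge> (2 :: real)"
    by (simp add: lessThan_nat_numeral fact_numeral power_divide)
  ultimately have "2 \<le> exp ((7 / 10) :: real)"
    by linarith
  then show "ln (2::real) \<le> (7 / 10)"
    by (metis ln_exp ln_le_cancel_iff exp_gt_zero zero_less_numeral)
qed

text \<open>Cosine changes sign at \<open>pi / 2\<close>. Taylor polynomials with error
  \<open>x ^ n / fact n\<close> show that it is positive at \<open>31 / 20\<close> and negative at
  \<open>63 / 40\<close>.\<close>

lemma pi_bounds: "(31 / 10) \<le> pi" "pi \<le> (63 / 20)"
proof -
  have cos: "\<bar>cos x - (\<Sum>m<n. cos_coeff m * x ^ m)\<bar> \<le> x ^ n / fact n" if "0 \<le> x" for x :: real and n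
  proof -
    obtain t where "cos x = (\<Sum>m<n. cos_coeff m * x ^ m) + (cos (t + 1/2 * real n * pi) / fact n) * x ^ n"
      using Maclaurin_cos_expansion by blast
    then have "\<bar>cos x - (\<Sum>m<n. cos_coeff m * x ^ m)\<bar>
        = \<bar>cos (t + 1/2 * real n * pi)\<bar> * (x ^ n / fact n)"
      using that by (simp add: abs_mult)
    also have "\<dots> \<le> 1 * (x ^ n / fact n)"
      by (rule mult_right_mono) (use that in auto)
    finally show ?thesis by simp
  qed
  show "(31 / 10) \<le> pi"
  proof (rule ccontr)
    assume "\<not> (31 / 10) \<le> pi"
    then have "cos (31 / 20) \<le> cos (pi / 2)"
      using pi_ge_two by (intro cos_monotone_0_pi_le) auto
    then show False
      using cos[of "(31 / 20)" 6] by (simp add: lessThan_nat_numeral fact_numeral cos_coeff_def power_divide)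
  qed
  show "pi \<le> (63 / 20)"
  proof (rule ccontr)
    assume "\<not> pi \<le> (63 / 20)"
    then have "0 \<le> cos (63 / 40 :: real)"
      by (intro cos_ge_zero) auto
    then show False
      using cos[of "(63 / 40)" 8] by (simp add: lessThan_nat_numeral fact_numeral cos_coeff_def power_divide)
  qed
qed

lemma Amat_0 [simp]: "Amat 0 j = (if j = 0 then 1 / 2 else if j = 1 then - 1 else 0)"
  by (simp add: Amat_def)

text \<open>For \<open>j \<ge> 2\<close> the binomial coefficient vanishes. Hence only column 0 has
  infinitely many nonzero entries, and sums along any other column are finite.\<close>

lemma Amat_lower_zero: "1 \<le> j \<Longrightarrow> j < i \<Longrightarrow> Amat i j = 0"
  by (auto simp: Amat_def Let_def)

lemma Amat_1_1: "Amat 1 1 = 1 / 2 + ln 2"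
  by (simp add: Amat_def)

lemma Amat_small:
  "Amat 1 2 = 1 / 4" "Amat 1 3 = 1 / 2" "Amat 2 2 = - 1 / 4" "Amat 2 3 = - 1 / 2" "Amat 3 3 = 0"
  by (simp_all add: Amat_def Let_def eval_nat_numeral)

section \<open>Numerical bounds for column 0\<close>

lemma Amat_1_0_bounds: "0 \<le> Amat 1 0" "Amat 1 0 \<le> (9 / 250)"
proof -
  let ?f = "\<lambda>m. (- 1) ^ (m + 1) / (real (m + 1) ^ 2 * 2 ^ (m + 1)) :: real"
  have "\<bar>?f (m + 5)\<bar> \<le> 1 / (36 * 64) * (1 / 2) ^ m" for m
  proof -
    have "\<bar>?f (m + 5)\<bar> = 1 / (real (m + 6) ^ 2 * 2 ^ (m + 6))"
      by (simp add: abs_mult power_abs add.commute)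
    also have "\<dots> \<le> 1 / (6 ^ 2 * 2 ^ (m + 6))"
      by (intro divide_left_mono mult_right_mono power_mono) auto
    finally show ?thesis
      by (simp add: power_add field_simps)
  qed
  from suminf_partial_sum_error(2)[of ?f, OF this]
  have "\<bar>suminf ?f - sum ?f {..<5}\<bar> \<le> 1 / (36 * 32)"
    by simp
  moreover have "sum ?f {..<5} \<ge> - (44874 / 100000)" "sum ?f {..<5} \<le> - (44872 / 100000)"
    by (simp_all add: lessThan_nat_numeral)
  \<comment> \<open>The three terms nearly cancel and leave about 0.027, so the sign is decided only
    by sharp enclosures of \<open>pi\<close>, \<open>ln 2\<close> and the series.\<close>
  moreover have "Amat 1 0 = pi ^ 2 / 12 + suminf ?f - ln 2 / 2"
    by (simp add: Amat_def)
  moreover have "(31 / 10) ^ 2 \<le> pi ^ 2" "pi ^ 2 \<le> (63 / 20) ^ 2"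
    using pi_bounds by (intro power_mono; simp)+
  then have "(961 / 100 )\<le> pi ^ 2" "pi ^ 2 \<le> (99225 / 10000)"
    by (simp_all add: power2_eq_square)
  ultimately show "0 \<le> Amat 1 0" "Amat 1 0 \<le> (9 / 250)"
    using ln_2_bounds by linarith+
qed

text \<open>The tail, from index \<open>r\<close> on, of the series of
  \<open>- ln (1 - 1 / 3) = ln (3 / 2)\<close>.\<close>

definition log_tail :: "nat \<Rightarrow> real" where
  "log_tail r = (\<Sum>m. 1 / (real (r + m) * 3 ^ (r + m)))"

text \<open>All terms are positive, so partial sums are lower bounds. The remainder after
  \<open>N\<close> terms has a geometric majorant of ratio \<open>1 / 3\<close>, whence the factor
  \<open>3 / 2\<close>.\<close>

lemma log_tail_bounds:
  assumes "1 \<le> r"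
  shows "(\<Sum>m<N. 1 / (real (r + m) * 3 ^ (r + m))) \<le> log_tail r"
    and "log_tail r \<le> (\<Sum>m<N. 1 / (real (r + m) * 3 ^ (r + m))) + 3 / (2 * real (r + N) * 3 ^ (r + N))"
proof -
  let ?f = "\<lambda>m. 1 / (real (r + m) * 3 ^ (r + m)) :: real"
  have *: "\<bar>?f (m + N)\<bar> \<le> 1 / (real (r + N) * 3 ^ (r + N)) * (1 / 3) ^ m" for m
  proof -
    have "\<bar>?f (m + N)\<bar> \<le> 1 / (real (r + N) * 3 ^ (r + (m + N)))"
      using assms by (auto intro!: divide_left_mono mult_right_mono mult_pos_pos)
    also have "\<dots> = 1 / (real (r + N) * 3 ^ (r + N)) * (1 / 3) ^ m"
      by (simp add: power_add field_simps)
    finally show ?thesis .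
  qed
  note err = suminf_partial_sum_error[of ?f, OF *]
  show "sum ?f {..<N} \<le> log_tail r"
    unfolding log_tail_def by (rule sum_le_suminf) (use err in auto)
  have "log_tail r \<le> sum ?f {..<N} + 1 / (real (r + N) * 3 ^ (r + N)) / (1 - 1 / 3)"
    unfolding log_tail_def using err(2) by linarith
  also have "1 / (real (r + N) * 3 ^ (r + N)) / (1 - 1 / 3) = 3 / (2 * real (r + N) * 3 ^ (r + N))"
    by simp
  finally show "log_tail r \<le> sum ?f {..<N} + 3 / (2 * real (r + N) * 3 ^ (r + N))" .
qed

lemma Amat_Suc_0: "1 \<le> r \<Longrightarrow> Amat (Suc r) 0 = (- 1) ^ r / real r * log_tail r"
  by (simp add: Amat_def log_tail_def)

lemma Amat_2_0_bounds: "- (203 / 500) \<le> Amat 2 0" "Amat 2 0 \<le> - (401 / 1000)"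
  using log_tail_bounds[of 1 3] Amat_Suc_0[of 1]
  by (simp_all add: lessThan_nat_numeral numeral_2_eq_2)

lemma Amat_3_0_bounds: "0 \<le> Amat 3 0" "Amat 3 0 \<le> (37 / 1000)"
  using log_tail_bounds[of 2 2] Amat_Suc_0[of 2]
  by (simp_all add: lessThan_nat_numeral numeral_3_eq_3)

text \<open>With \<open>r = i - 1\<close> the tail bound gives
  \<open>3 / (2 * r ^ 2 * 3 ^ r)\<close>. Replacing \<open>r ^ 2\<close> by 9 leaves a geometric
  sequence that starts at \<open>1 / 162\<close>.\<close>

lemma abs_Amat_col_0_le:
  assumes "4 \<le> i"
  shows "\<bar>Amat i 0\<bar> \<le> 1 / 162 * (1 / 3) ^ (i - 4)"
proof -
  obtain r where r: "i = Suc r" "3 \<le> r"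
    using assms by (cases i) auto
  have pos: "0 \<le> log_tail r" and le: "log_tail r \<le> 3 / (2 * real r * 3 ^ r)"
    using log_tail_bounds[of r 0] r by auto
  have "\<bar>Amat i 0\<bar> = log_tail r / real r"
    using pos r by (simp add: Amat_Suc_0 abs_mult power_abs)
  also have "\<dots> \<le> 3 / (2 * real r * 3 ^ r) / real r"
    by (rule divide_right_mono[OF le]) simp
  also have "\<dots> = 3 / (2 * 3 ^ r * (real r * real r))"
    by simp
  also have "\<dots> \<le> 3 / (2 * 3 ^ r * (3 * 3))"
    using r by (intro divide_left_mono mult_left_mono mult_mono) auto
  also have "\<dots> = 1 / 162 * (1 / 3) ^ (i - 4)"
    using r power_add[of "3::real" "r - 3" 3] by (simp add: field_simps)
  finally show ?thesis .
qed

lemma sum_abs_Amat_col_0_from_4: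
  "(\<Sum>i=4..<n. \<bar>Amat i 0\<bar>) \<le> (93 / 10000)"
proof -
  have "(\<Sum>i=4..<n. \<bar>Amat i 0\<bar>) \<le> (\<Sum>i=4..<n. 1 / 162 * (1 / 3) ^ (i - 4))"
    by (intro sum_mono abs_Amat_col_0_le) auto
  also have "\<dots> = (\<Sum>m<n-4. 1 / 162 * (1 / 3) ^ m)"
    by (rule sum.reindex_bij_witness[of _ "\<lambda>m. m + 4" "\<lambda>i. i - 4"]) auto
  also have "\<dots> = 1 / 162 * (\<Sum>m<n-4. (1 / 3) ^ m)"
    by (simp add: sum_distrib_left)
  also have "\<dots> \<le> 1 / 162 * (3 / 2)"
    by (intro mult_left_mono) (simp_all only: sum_gp_strict, simp_all)
  finally show ?thesis by simp
qed

text \<open>The constant is \<open>203 / 500 + 37 / 1000 + 93 / 10000\<close>, from row 2, row 3 and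
  the geometric tail.\<close>

lemma sum_abs_Amat_col_0_from_2:
  "(\<Sum>i=2..<n. \<bar>Amat i 0\<bar>) \<le> (4523 / 10000)"
proof -
  have "(\<Sum>i=2..<n. \<bar>Amat i 0\<bar>) \<le> (\<Sum>i=2..<max n 4. \<bar>Amat i 0\<bar>)"
    by (rule sum_mono2) auto
  also have "\<dots> = (\<Sum>i=2..<4. \<bar>Amat i 0\<bar>) + (\<Sum>i=4..<max n 4. \<bar>Amat i 0\<bar>)"
    by (rule sum.atLeastLessThan_concat[symmetric]) auto
  also have "(\<Sum>i=2..<4. \<bar>Amat i 0\<bar>) = \<bar>Amat 2 0\<bar> + \<bar>Amat 3 0\<bar>"
    by (simp add: eval_nat_numeral)
  finally show ?thesis
    using sum_abs_Amat_col_0_from_4[of "max n 4"] Amat_2_0_bounds Amat_3_0_bounds by linarith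
qed

section \<open>Row 1 and the columns from 2 on\<close>

lemma abs_Amat_1_le: assumes "2 \<le> j" shows "\<bar>Amat 1 j\<bar> \<le> 1 / 2"
proof (cases "j \<le> 3")
  case True
  with assms have "j = 2 \<or> j = 3" by auto
  then show ?thesis using Amat_small by auto
next
  case False
  define k where "k = j - 1"
  have k: "3 \<le> k" "j = Suc k" using False k_def by auto
  \<comment> \<open>The two terms with denominator \<open>k\<close> are together at most
    \<open>1 / 3\<close>, the alternating one at most \<open>1 / 16\<close>. Column 3, treated
    explicitly, attains \<open>1 / 2\<close>.\<close>
  have A: "Amat 1 j = (1 / real k) * (1 - 1 / 2 ^ k) + (- 1) ^ k / 2 ^ (k + 1)"
    using k by (simp add: Amat_def Let_def right_diff_distrib)
  have "0 \<le> 1 - 1 / (2::real) ^ k" by simp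
  then have "\<bar>(1 / real k) * (1 - 1 / 2 ^ k)\<bar> \<le> (1 / 3) * 1"
    unfolding abs_mult using k by (intro mult_mono) (auto simp: field_simps)
  moreover have "\<bar>(- 1) ^ k / 2 ^ (k + 1) :: real\<bar> = 1 / 2 ^ (k + 1)"
    by (simp add: power_abs)
  moreover have "1 / (2::real) ^ (k + 1) \<le> 1 / 2 ^ 4"
    using k by (intro divide_left_mono power_increasing) auto
  then have "1 / (2::real) ^ (k + 1) \<le> 1 / 16"
    by simp
  ultimately show ?thesis
    unfolding A using abs_triangle_ineq[of "(1 / real k) * (1 - 1 / 2 ^ k)" "(- 1) ^ k / 2 ^ (k + 1)"]
    by linarith
qed

text \<open>For \<open>k \<ge> 2\<close> the bracket in the entry has absolute value \<open>2^(-k) (1/2 - (-1)^(k - r)/k)\<close>,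
  and the alternating part cancels in the sum over \<open>r\<close>.\<close>

lemma sum_abs_Amat_col_from_2:
  assumes "2 \<le> j"
  shows "(\<Sum>i=2..<n. \<bar>Amat i j\<bar>) \<le> 1 / 2"
proof -
  define k where "k = j - 1"
  have k: "1 \<le> k" "j = Suc k" using assms k_def by auto
  have "(\<Sum>i=2..<n. \<bar>Amat i j\<bar>) = (\<Sum>i\<in>{2..<n} \<inter> {2..j}. \<bar>Amat i j\<bar>)"
    using assms by (intro sum.mono_neutral_right) (auto intro!: Amat_lower_zero)
  also have "\<dots> \<le> (\<Sum>i\<in>{2..j}. \<bar>Amat i j\<bar>)"
    by (rule sum_mono2) auto
  also have "\<dots> = (\<Sum>r\<in>{1..k}. \<bar>Amat (Suc r) j\<bar>)"
    by (rule sum.reindex_bij_witness[of _ Suc "\<lambda>i. i - 1"]) (auto simp: k)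
  also have "\<dots> \<le> 1 / 2"
  \<comment> \<open>For \<open>k = 1\<close> the formula for the absolute value of the bracket has
    the wrong sign; the only entry is \<open>- 1 / 4\<close>.\<close>
  proof (cases "k = 1")
    case True
    then show ?thesis using Amat_small k by (simp add: numeral_2_eq_2)
  next
    case False
    then have k2: "2 \<le> k" using k by simp
    define g where "g r = real (k choose r) * (1 / 2 - (- 1) ^ (k - r) / real k) / 2 ^ k" for r
    have g: "\<bar>Amat (Suc r) j\<bar> = g r" if "r \<in> {1..k}" for r
    proof -
      have "Amat (Suc r) j = real (k choose r) * ((- 1) ^ (k - r) / 2 - 1 / real k) / 2 ^ k"
        using that k by (simp add: Amat_def Let_def field_simps)
      moreover have "\<bar>(- 1) ^ (k - r) / 2 - 1 / real k\<bar> = 1 / 2 - (- 1) ^ (k - r) / real k"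
        using k2 by (cases "even (k - r)") (auto simp: field_simps abs_if)
      ultimately show ?thesis
        by (simp add: g_def abs_mult)
    qed
    have alt: "(\<Sum>r\<le>k. real (k choose r) * (- 1) ^ (k - r)) = 0"
      using k binomial_ring[of 1 "-1 :: real" k] by (simp add: zero_power)
    have "(\<Sum>r\<in>{1..k}. \<bar>Amat (Suc r) j\<bar>) = (\<Sum>r\<in>{1..k}. g r)"
      by (rule sum.cong[OF refl g])
    \<comment> \<open>Adding the term \<open>r = 0\<close> completes both binomial sums. It is
      nonnegative because \<open>(- 1) ^ k / k\<close> is at most \<open>1 / 2\<close> for
      \<open>k \<ge> 2\<close>.\<close>
    also have "\<dots> \<le> (\<Sum>r\<le>k. g r)"
    proof (rule sum_mono2)
      have "(- 1) ^ k / real k \<le> 1 / 2"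
        using k2 by (cases "even k") (auto simp: field_simps)
      then show "0 \<le> g r" if "r \<in> {..k} - {1..k}" for r
        using that by (cases r) (auto simp: g_def)
    qed auto
    also have "\<dots> = ((\<Sum>r\<le>k. real (k choose r)) / 2
        - (\<Sum>r\<le>k. real (k choose r) * (- 1) ^ (k - r)) / real k) / 2 ^ k"
      by (simp add: g_def sum_divide_distrib sum_subtractf[symmetric] right_diff_distrib diff_divide_distrib)
    also have "(\<Sum>r\<le>k. real (k choose r)) = 2 ^ k"
      by (metis choose_row_sum of_nat_sum of_nat_power of_nat_numeral)
    finally show ?thesis unfolding alt by simp
  qed
  finally show ?thesis .
qed

section \<open>A lower bound for the dominant eigenvalue\<close>

text \<open>The divisor \<open>c\<close> serves to scale the truncation to spectral radius below 1;
  \<open>c = 1\<close> gives the plain row action.\<close>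

definition row_step :: "nat \<Rightarrow> real \<Rightarrow> (nat \<Rightarrow> real) \<Rightarrow> nat \<Rightarrow> real" where
  "row_step n c x j = (\<Sum>i<n+1. x i * Amat i j) / c"

text \<open>The constants enclose the left eigenvector scaled to \<open>x\<^sub>1 = 1\<close>, which begins
  \<open>(-0.04, 1, 0.169, 0.337, 0.111, \<dots>)\<close>. The upper bound \<open>x\<^sub>0 \<le> 0\<close> makes coordinate 1 grow, and it is
  preserved only because \<open>x\<^sub>2\<close> is bounded below.\<close>

definition dominance_cone :: "nat \<Rightarrow> (nat \<Rightarrow> real) \<Rightarrow> bool" where
  "dominance_cone n x \<longleftrightarrow> 0 < x 1 \<and> - 1 / 5 * x 1 \<le> x 0 \<and> x 0 \<le> 0
    \<and> 71 / 500 * x 1 \<le> x 2 \<and> x 2 \<le> 1 / 5 * x 1 \<and> 0 \<le> x 3 \<and> x 3 \<le> 37 / 100 * x 1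
    \<and> (\<forall>j\<in>{4..n}. \<bar>x j\<bar> \<le> 3 / 4 * x 1)"

lemma dominance_cone_divide:
  assumes "dominance_cone n x" "0 < c"
  shows "dominance_cone n (\<lambda>j. x j / c)"
  using assms unfolding dominance_cone_def
  by (auto simp: field_simps abs_div)

lemma abs_sum_mult_le:
  fixes a x :: "'a \<Rightarrow> real"
  assumes "\<And>i. i \<in> S \<Longrightarrow> \<bar>x i\<bar> \<le> B" "(\<Sum>i\<in>S. \<bar>a i\<bar>) \<le> K" "0 \<le> B"
  shows "\<bar>\<Sum>i\<in>S. x i * a i\<bar> \<le> K * B"
proof -
  have "\<bar>\<Sum>i\<in>S. x i * a i\<bar> \<le> (\<Sum>i\<in>S. \<bar>x i\<bar> * \<bar>a i\<bar>)"
    by (rule order_trans[OF sum_abs]) (simp add: abs_mult)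
  also have "\<dots> \<le> (\<Sum>i\<in>S. B * \<bar>a i\<bar>)"
    using assms by (intro sum_mono mult_right_mono) auto
  also have "\<dots> = B * (\<Sum>i\<in>S. \<bar>a i\<bar>)"
    by (simp add: sum_distrib_left)
  also have "\<dots> \<le> B * K"
    using assms by (intro mult_left_mono) auto
  finally show ?thesis by (simp add: mult.commute)
qed

lemma sum_split_2:
  fixes f :: "nat \<Rightarrow> real"
  shows "2 \<le> m \<Longrightarrow> sum f {..<m} = f 0 + f 1 + sum f {2..<m}"
  using sum.atLeastLessThan_concat[of 0 2 m f]
  by (simp add: atLeast0LessThan lessThan_nat_numeral)

lemma sum_split_4:
  fixes f :: "nat \<Rightarrow> real"
  shows "4 \<le> m \<Longrightarrow> sum f {..<m} = f 0 + f 1 + f 2 + f 3 + sum f {4..<m}"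
  using sum.atLeastLessThan_concat[of 0 4 m f]
  by (simp add: atLeast0LessThan lessThan_nat_numeral)

lemma Amat_1_1_bounds: "149 / 125 \<le> Amat 1 1" "Amat 1 1 \<le> 6 / 5"
  using ln_2_bounds by (simp_all only: Amat_1_1)

text \<open>Columns 1 to 3 vanish below the diagonal, so the new coordinates 1, 2, 3 are explicit
  linear forms. All bounds are compared with the new coordinate 1, which lies between
  \<open>149 / 125 * x 1\<close> and \<open>7 / 5 * x 1\<close>.\<close>

lemma dominance_cone_row_step_1:
  assumes x: "dominance_cone n x" and n: "3 \<le> n"
  shows "dominance_cone n (row_step n 1 x)" and "Amat 1 1 * x 1 \<le> row_step n 1 x 1"
proof -
  note x = x[unfolded dominance_cone_def]
  let ?y = "row_step n 1 x"
  have y: "?y j = x 0 * Amat 0 j + x 1 * Amat 1 j + x 2 * Amat 2 j + x 3 * Amat 3 j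
      + (\<Sum>i=4..<n+1. x i * Amat i j)" for j
    unfolding row_step_def using n by (subst sum_split_4) auto
  have y': "?y j = x 0 * Amat 0 j + x 1 * Amat 1 j + (\<Sum>i=2..<n+1. x i * Amat i j)" for j
    unfolding row_step_def using n by (subst sum_split_2) auto
  have tail: "(\<Sum>i=4..<n+1. x i * Amat i j) = 0" if "j \<in> {1,2,3}" for j
    using that by (intro sum.neutral) (auto simp: Amat_lower_zero)
  have A2: "Amat 2 1 = 0" "Amat 3 1 = 0" "Amat 3 2 = 0"
    by (simp_all add: Amat_lower_zero)
  define b where "b = Amat 1 1 * x 1"
  have y1: "?y 1 = b - x 0"
    unfolding y b_def by (subst tail) (simp_all add: A2[unfolded One_nat_def])
  have y2: "?y 2 = x 1 / 4 - x 2 / 4"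
    unfolding y by (subst tail) (simp_all add: A2[unfolded One_nat_def] Amat_small[unfolded One_nat_def])
  have y3: "?y 3 = x 1 / 2 - x 2 / 2"
    unfolding y by (subst tail) (simp_all add: A2[unfolded One_nat_def] Amat_small[unfolded One_nat_def])
  define S where "S = (\<Sum>i=4..<n+1. x i * Amat i 0)"
  have "\<bar>S\<bar> \<le> 93 / 10000 * (3 / 4 * x 1)"
    unfolding S_def by (rule abs_sum_mult_le[OF _ sum_abs_Amat_col_0_from_4]) (use x in auto)
  moreover have "?y 0 = x 0 / 2 + x 1 * Amat 1 0 + x 2 * Amat 2 0 + x 3 * Amat 3 0 + S"
    unfolding y S_def by simp
  moreover have "0 \<le> x 1 * Amat 1 0" "x 1 * Amat 1 0 \<le> x 1 * (9 / 250)"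
    using x Amat_1_0_bounds by (auto intro: mult_left_mono)
  moreover have "- (x 2 * Amat 2 0) \<le> 1 / 5 * x 1 * (203 / 500)"
    "71 / 500 * x 1 * (401 / 1000) \<le> - (x 2 * Amat 2 0)"
    unfolding mult_minus_right[symmetric]
    by (rule mult_mono; use x Amat_2_0_bounds in auto)+
  moreover have "x 3 * Amat 3 0 \<le> 37 / 100 * x 1 * (37 / 1000)" "0 \<le> x 3 * Amat 3 0"
    by (rule mult_mono mult_nonneg_nonneg; use x Amat_3_0_bounds in auto)+
  \<comment> \<open>The margin at 0 is thin: relative to \<open>x 1\<close>, row 2 contributes at
    most -0.0569, while rows 1, 3 and those from 4 on contribute at most 0.0567.\<close>
  ultimately have y0: "?y 0 \<le> 0" "- 1 / 5 * (149 / 125 * x 1) \<le> ?y 0"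
    using x by linarith+
  have b: "149 / 125 * x 1 \<le> b" "b \<le> 6 / 5 * x 1"
    unfolding b_def using x Amat_1_1_bounds by (auto intro!: mult_right_mono)
  \<comment> \<open>Relative to \<open>x 1\<close>, row 1 contributes at most \<open>1 / 2\<close>
    and the rows from 2 on at most \<open>3 / 8\<close>; their sum is below
    \<open>3 / 4 * 149 / 125\<close>.\<close>
  have yj: "\<bar>?y j\<bar> \<le> 3 / 4 * ?y 1" if "j \<in> {4..n}" for j
  proof -
    define p q where "p = x 1 * Amat 1 j" and "q = (\<Sum>i=2..<n+1. x i * Amat i j)"
    have q: "\<bar>q\<bar> \<le> 1 / 2 * (3 / 4 * x 1)"
      unfolding q_def
    proof (rule abs_sum_mult_le[OF _ sum_abs_Amat_col_from_2])
      fix i assume "i \<in> {2..<n+1}"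
      then have "i = 2 \<or> i = 3 \<or> i \<in> {4..n}" by auto
      then show "\<bar>x i\<bar> \<le> 3 / 4 * x 1" using x by auto
    qed (use x that in auto)
    have p: "\<bar>p\<bar> \<le> x 1 * (1 / 2)"
      unfolding p_def abs_mult by (rule mult_mono) (use x that abs_Amat_1_le in auto)
    have "?y j = p + q"
      unfolding y' p_def q_def using that by simp
    then show ?thesis unfolding y1 right_diff_distrib using b x p q by linarith
  qed
  show "Amat 1 1 * x 1 \<le> ?y 1"
    unfolding y1 b_def[symmetric] using x by simp
  show "dominance_cone n ?y"
    unfolding dominance_cone_def
    using yj x b y0 unfolding y1 y2 y3 right_diff_distrib by (intro conjI) (linarith | blast)+
qed

lemma dominance_cone_row_step:
  assumes x: "dominance_cone n x" and "3 \<le> n" "0 < c"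
  shows "dominance_cone n (row_step n c x)" and "Amat 1 1 / c * x 1 \<le> row_step n c x 1"
proof -
  have *: "row_step n c x = (\<lambda>j. row_step n 1 x j / c)"
    by (auto simp: row_step_def)
  show "dominance_cone n (row_step n c x)"
    unfolding * by (intro dominance_cone_divide dominance_cone_row_step_1 assms)
  show "Amat 1 1 / c * x 1 \<le> row_step n c x 1"
    unfolding * using dominance_cone_row_step_1(2)[OF assms(1,2)] assms(3)
    by (simp add: divide_right_mono)
qed

lemma row_step_funpow:
  assumes "dominance_cone n x" "3 \<le> n" "0 < c"
  shows "dominance_cone n ((row_step n c ^^ k) x) \<and> (Amat 1 1 / c) ^ k * x 1 \<le> (row_step n c ^^ k) x 1"
proof (induction k)
  case (Suc k)
  let ?z = "(row_step n c ^^ k) x"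
  have "(Amat 1 1 / c) ^ Suc k * x 1 = Amat 1 1 / c * ((Amat 1 1 / c) ^ k * x 1)"
    by simp
  also have "\<dots> \<le> Amat 1 1 / c * ?z 1"
    using Suc assms Amat_1_1_bounds by (intro mult_left_mono) auto
  also have "\<dots> \<le> row_step n c ?z 1"
    using Suc assms by (intro dominance_cone_row_step) auto
  finally show ?case
    using Suc assms by (simp add: dominance_cone_row_step)
qed (use assms in auto)

section \<open>Transfer to powers of complex matrices\<close>

definition cvec :: "nat \<Rightarrow> (nat \<Rightarrow> real) \<Rightarrow> complex vec" where
  "cvec n x = vec (n + 1) (\<lambda>i. complex_of_real (x i))"

text \<open>Transposition turns the row action into a matrix-vector product; complex entries make
  the spectral radius available.\<close>

definition scaled_transpose :: "nat \<Rightarrow> real \<Rightarrow> complex mat" where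
  "scaled_transpose n c = mat (n + 1) (n + 1) (\<lambda>(j, i). complex_of_real (Amat i j / c))"

lemma scaled_transpose_carrier [simp]:
  "scaled_transpose n c \<in> carrier_mat (n + 1) (n + 1)"
  "scaled_transpose n c \<in> carrier_mat (Suc n) (Suc n)"
  by (simp_all add: scaled_transpose_def)

lemma scaled_transpose_mult_cvec: "scaled_transpose n c *\<^sub>v cvec n x = cvec n (row_step n c x)"
  by (rule eq_vecI)
     (auto simp: scaled_transpose_def cvec_def row_step_def scalar_prod_def atLeast0LessThan
       sum_divide_distrib add_divide_distrib mult.commute intro!: sum.cong)

lemma scaled_transpose_pow_mult_cvec:
  "(scaled_transpose n c ^\<^sub>m k) *\<^sub>v cvec n x = cvec n ((row_step n c ^^ k) x)"
proof (induction k arbitrary: x)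
  case 0
  show ?case by (simp add: scaled_transpose_def cvec_def)
next
  case (Suc k)
  have "(scaled_transpose n c ^\<^sub>m Suc k) *\<^sub>v cvec n x
      = (scaled_transpose n c ^\<^sub>m k) *\<^sub>v (scaled_transpose n c *\<^sub>v cvec n x)"
    unfolding pow_mat.simps
    by (rule assoc_mult_mat_vec[of _ "n + 1" "n + 1" _ "n + 1"])
       (auto simp: cvec_def intro!: pow_carrier_mat)
  then show ?case
    by (simp add: scaled_transpose_mult_cvec Suc funpow_swap1)
qed

text \<open>A matrix and its transpose have the same characteristic polynomial, and division by
  \<open>c\<close> divides the eigenvalues by \<open>c\<close>.\<close>

lemma eigenvalue_scaled_transpose:
  assumes "eigenvalue (scaled_transpose n c) \<mu>" "c \<noteq> 0"
  shows "eigenvalue (map_mat complex_of_real (A_trunc n)) (of_real c * \<mu>)"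
proof -
  let ?C = "map_mat complex_of_real (A_trunc n)"
  have C: "?C \<in> carrier_mat (n + 1) (n + 1)"
    by (simp add: A_trunc_def)
  have CT: "?C\<^sup>T = complex_of_real c \<cdot>\<^sub>m scaled_transpose n c"
    using assms(2) by (intro eq_matI) (auto simp: A_trunc_def scaled_transpose_def)
  obtain z where z: "z \<in> carrier_vec (n + 1)" "z \<noteq> 0\<^sub>v (n + 1)" "scaled_transpose n c *\<^sub>v z = \<mu> \<cdot>\<^sub>v z"
    using assms(1) unfolding eigenvalue_def eigenvector_def by (auto simp: scaled_transpose_def)
  have "?C\<^sup>T *\<^sub>v z = complex_of_real c \<cdot>\<^sub>v (scaled_transpose n c *\<^sub>v z)"
    unfolding CT using z(1) by (intro eq_vecI) (auto simp: scaled_transpose_def)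
  also have "\<dots> = (of_real c * \<mu>) \<cdot>\<^sub>v z"
    using z by (simp add: smult_smult_assoc)
  finally have "eigenvalue ?C\<^sup>T (of_real c * \<mu>)"
    using z unfolding eigenvalue_def eigenvector_def by (auto simp: A_trunc_def)
  moreover have "?C\<^sup>T \<in> carrier_mat (n + 1) (n + 1)"
    using C by simp
  ultimately show ?thesis
    using eigenvalue_root_char_poly char_poly_transpose_mat[OF C] C by metis
qed

text \<open>If \<open>\<bar>l\<bar> < c < Amat 1 1\<close>, the truncation divided by
  \<open>c\<close> has spectral radius below 1 and hence bounded powers. Along the cone, however,
  coordinate 1 grows at least like \<open>(Amat 1 1 / c) ^ k\<close>.\<close>

lemma dominant_eigenvalue_ge:
  assumes n: "3 \<le> n" and dom: "simple_dominant_eigenvalue (A_trunc n) l"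
  shows "Amat 1 1 \<le> \<bar>l\<bar>"
proof (rule ccontr)
  assume "\<not> Amat 1 1 \<le> \<bar>l\<bar>"
  then obtain c where c: "\<bar>l\<bar> < c" "c < Amat 1 1"
    by (metis dense not_le)
  then have c0: "0 < c" by auto
  let ?D = "scaled_transpose n c"
  obtain \<mu> where \<mu>: "eigenvalue ?D \<mu>" "spectral_radius ?D = cmod \<mu>"
    using spectral_radius_mem_max(1)[of ?D "n + 1"] by (auto simp: spectrum_def)
  have "cmod (of_real c * \<mu>) \<le> \<bar>l\<bar>"
    using eigenvalue_scaled_transpose[OF \<mu>(1)] c0 dom
    unfolding simple_dominant_eigenvalue_def Let_def
    by (cases "of_real c * \<mu> = complex_of_real l") (auto simp: less_imp_le)
  then have "c * cmod \<mu> \<le> \<bar>l\<bar>"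
    using c0 by (simp add: norm_mult)
  then have "c * cmod \<mu> < c * 1"
    using c by linarith
  then have "spectral_radius ?D < 1"
    using c0 \<mu> by simp
  then obtain b where b: "\<And>k. norm_bound (?D ^\<^sub>m k) b"
    using spectral_radius_jnf_norm_bound_less_1_upper_triangular[of ?D "n + 1"] by auto
  \<comment> \<open>The unit vector of index 1 lies outside the cone, because coordinate 2 has a
    positive lower bound; \<open>3 / 20\<close> lies between \<open>71 / 500\<close> and
    \<open>1 / 5\<close>.\<close>
  define x :: "nat \<Rightarrow> real" where "x i = (if i = 1 then 1 else if i = 2 then 3 / 20 else 0)" for i
  have x: "dominance_cone n x"
    by (simp add: dominance_cone_def x_def)
  have "(Amat 1 1 / c) ^ k \<le> b * (\<Sum>i<n+1. \<bar>x i\<bar>)" for k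
  proof -
    let ?P = "?D ^\<^sub>m k"
    have P: "?P \<in> carrier_mat (n + 1) (n + 1)"
      by (intro pow_carrier_mat) simp
    have "(Amat 1 1 / c) ^ k \<le> (row_step n c ^^ k) x 1"
      using row_step_funpow[OF x n c0, of k] by (simp add: x_def)
    also have "\<dots> \<le> cmod (cvec n ((row_step n c ^^ k) x) $ 1)"
      using n by (simp add: cvec_def)
    also have "\<dots> = cmod (\<Sum>i<n+1. ?P $$ (1, i) * complex_of_real (x i))"
      unfolding scaled_transpose_pow_mult_cvec[symmetric] using n carrier_matD[OF P]
      by (subst index_mult_mat_vec) (auto simp: scalar_prod_def cvec_def atLeast0LessThan)
    also have "\<dots> \<le> (\<Sum>i<n+1. b * \<bar>x i\<bar>)"
    proof (rule sum_norm_le)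
      fix i assume "i \<in> {..<n+1}"
      then have "cmod (?P $$ (1, i)) \<le> b"
        using b[of k] carrier_matD[OF P] n unfolding norm_bound_def by simp
      then show "cmod (?P $$ (1, i) * complex_of_real (x i)) \<le> b * \<bar>x i\<bar>"
        by (simp add: norm_mult mult_right_mono)
    qed
    finally show ?thesis
      by (simp only: sum_distrib_left)
  qed
  moreover have "1 < Amat 1 1 / c"
    using c c0 by simp
  ultimately show False
    using real_arch_pow[of "Amat 1 1 / c" "b * (\<Sum>i<n+1. \<bar>x i\<bar>)"] by (meson not_less)
qed

section \<open>The operator on summable sequences\<close>

definition tail1 :: "(nat \<Rightarrow> real) \<Rightarrow> real" where
  "tail1 x = (\<Sum>i. \<bar>x (i + 2)\<bar>)"

text \<open>Bounds for the absolute column sums over the rows from 2 on.\<close>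

definition col_tail :: "nat \<Rightarrow> real" where
  "col_tail j = (if j = 0 then 4523 / 10000 else if j = 1 then 0 else 1 / 2)"

lemma sum_shift_2: "sum f {2..<n+2} = (\<Sum>i<n. f (i + 2 :: nat))"
  using sum.shift_bounds_nat_ivl[of f 0 2 n] by (simp only: add_0 atLeast0LessThan)

lemma sum_abs_Amat_tail: "(\<Sum>i<n. \<bar>Amat (i + 2) j\<bar>) \<le> col_tail j"
proof -
  have "(\<Sum>i<n. \<bar>Amat (i + 2) j\<bar>) = (\<Sum>i=2..<n+2. \<bar>Amat i j\<bar>)"
    by (rule sum_shift_2[symmetric])
  moreover have "(\<Sum>i=2..<n+2. \<bar>Amat i j\<bar>) = 0" if "j = 1"
    using that by (intro sum.neutral) (auto simp: Amat_lower_zero)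
  ultimately show ?thesis
    using sum_abs_Amat_col_0_from_2[of "n+2"] sum_abs_Amat_col_from_2[of j "n+2"]
    by (auto simp: col_tail_def)
qed

lemma abs_Amat_row_0_1_le: "\<bar>Amat 0 j\<bar> \<le> 1" "\<bar>Amat 1 j\<bar> \<le> 6 / 5"
proof -
  consider "j = 0" | "j = 1" | "2 \<le> j" by linarith
  then show "\<bar>Amat 1 j\<bar> \<le> 6 / 5"
    using Amat_1_0_bounds Amat_1_1_bounds abs_Amat_1_le[of j] by cases auto
qed simp

text \<open>The constant rounds up \<open>1 + 6 / 5 + 1 / 2\<close>. Limit arguments need only its
  uniformity in \<open>n\<close> and \<open>j\<close>.\<close>

lemma sum_abs_Amat_col_le: "(\<Sum>i<n. \<bar>Amat i j\<bar>) \<le> 3"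
proof -
  have "(\<Sum>i<n. \<bar>Amat i j\<bar>) \<le> (\<Sum>i<n+2. \<bar>Amat i j\<bar>)"
    by (rule sum_mono2) auto
  also have "\<dots> = \<bar>Amat 0 j\<bar> + \<bar>Amat 1 j\<bar> + (\<Sum>i<n. \<bar>Amat (i + 2) j\<bar>)"
    by (simp only: sum_split_2[of "n + 2"] sum_shift_2 le_add2)
  also have "\<dots> \<le> 1 + 6 / 5 + 1 / 2"
    by (intro add_mono abs_Amat_row_0_1_le order_trans[OF sum_abs_Amat_tail])
       (simp add: col_tail_def)
  finally show ?thesis by simp
qed

lemma abs_Amat_le: "\<bar>Amat i j\<bar> \<le> 3"
  using order_trans[OF member_le_sum[of i "{..<i+1}" "\<lambda>i. \<bar>Amat i j\<bar>"] sum_abs_Amat_col_le] by simp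

text \<open>The factor \<open>a\<close> is controlled through finite partial sums, the form in which
  the column estimates are proved.\<close>

lemma bounded_mult_suminf:
  fixes a y :: "nat \<Rightarrow> real"
  assumes y: "\<And>i. \<bar>y i\<bar> \<le> B" and a: "\<And>n. (\<Sum>i<n. \<bar>a i\<bar>) \<le> K"
  shows "summable (\<lambda>i. \<bar>y i * a i\<bar>)" "\<bar>\<Sum>i. y i * a i\<bar> \<le> K * B"
proof -
  have B: "0 \<le> B" using y[of 0] by linarith
  have part: "(\<Sum>i<n. \<bar>y i * a i\<bar>) \<le> K * B" for n
  proof -
    have "\<bar>\<Sum>i<n. \<bar>y i\<bar> * \<bar>a i\<bar>\<bar> \<le> K * B"
      by (rule abs_sum_mult_le) (use y a B in auto)
    then show ?thesis by (simp add: abs_mult)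
  qed
  show s: "summable (\<lambda>i. \<bar>y i * a i\<bar>)"
    by (rule summableI_nonneg_bounded[OF _ part]) simp
  show "\<bar>\<Sum>i. y i * a i\<bar> \<le> K * B"
    by (rule order_trans[OF summable_rabs[OF s]]) (rule suminf_le_const[OF s part])
qed

section \<open>The space \<open>ell1\<close> and its pairing with bounded sequences\<close>

lemma ell1_abs_summable: "x \<in> ell1 \<Longrightarrow> summable (\<lambda>i. \<bar>x i\<bar>)"
  by (simp add: ell1_def)

lemma ell1_tail_summable: "x \<in> ell1 \<Longrightarrow> summable (\<lambda>i. \<bar>x (i + 2)\<bar>)"
  using summable_ignore_initial_segment ell1_abs_summable by blast

lemma tail1_nonneg: "x \<in> ell1 \<Longrightarrow> 0 \<le> tail1 x"
  unfolding tail1_def by (intro suminf_nonneg ell1_tail_summable) auto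

lemma norm1_eq: "x \<in> ell1 \<Longrightarrow> norm1 x = \<bar>x 0\<bar> + \<bar>x 1\<bar> + tail1 x"
  using suminf_split_initial_segment[OF ell1_abs_summable, of x 2]
  by (simp add: norm1_def tail1_def lessThan_nat_numeral)

lemma norm1_nonneg: "x \<in> ell1 \<Longrightarrow> 0 \<le> norm1 x"
  by (simp add: norm1_eq tail1_nonneg)

lemma abs_le_norm1: "x \<in> ell1 \<Longrightarrow> \<bar>x i\<bar> \<le> norm1 x"
  unfolding norm1_def using sum_le_suminf[OF ell1_abs_summable, of x "{i}"] by simp

lemma ell1_scale:
  assumes "x \<in> ell1"
  shows "(\<lambda>i. c * x i) \<in> ell1" and "norm1 (\<lambda>i. c * x i) = \<bar>c\<bar> * norm1 x"
  using assms unfolding ell1_def norm1_def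
  by (auto simp: abs_mult suminf_mult intro: summable_mult)

lemma ell1_add:
  assumes "x \<in> ell1" "y \<in> ell1"
  shows "(\<lambda>i. x i + y i) \<in> ell1" and "norm1 (\<lambda>i. x i + y i) \<le> norm1 x + norm1 y"
proof -
  have s: "summable (\<lambda>i. \<bar>x i\<bar> + \<bar>y i\<bar>)"
    using assms by (intro summable_add ell1_abs_summable)
  then have xy: "summable (\<lambda>i. \<bar>x i + y i\<bar>)"
    by (rule summable_comparison_test'[of _ 0]) auto
  then show "(\<lambda>i. x i + y i) \<in> ell1" by (simp add: ell1_def)
  show "norm1 (\<lambda>i. x i + y i) \<le> norm1 x + norm1 y"
    unfolding norm1_def suminf_add[OF assms[THEN ell1_abs_summable]]
    by (rule suminf_le[OF _ xy s]) auto
qed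

lemma ell1_diff: "x \<in> ell1 \<Longrightarrow> y \<in> ell1 \<Longrightarrow> (\<lambda>i. x i - y i) \<in> ell1"
  using ell1_add(1)[of x "\<lambda>i. - 1 * y i"] ell1_scale(1)[of y "- 1"] by simp

lemma bounded_mult_ell1_summable:
  assumes "x \<in> ell1" "\<And>i. \<bar>a i\<bar> \<le> B"
  shows "summable (\<lambda>i. \<bar>a i * x i\<bar>)" "summable (\<lambda>i. a i * x i)"
proof -
  show "summable (\<lambda>i. \<bar>a i * x i\<bar>)"
    by (rule summable_comparison_test'[OF summable_mult[OF ell1_abs_summable[OF assms(1)], of B], of 0])
       (auto simp: abs_mult assms(2) mult_right_mono)
  then show "summable (\<lambda>i. a i * x i)" by (rule summable_rabs_cancel)
qed

lemma abs_suminf_bounded_mult_le: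
  assumes "x \<in> ell1" "\<And>i. \<bar>a i\<bar> \<le> B"
  shows "\<bar>\<Sum>i. a i * x i\<bar> \<le> B * norm1 x"
proof -
  have "\<bar>\<Sum>i. a i * x i\<bar> \<le> (\<Sum>i. \<bar>a i * x i\<bar>)"
    by (rule summable_rabs bounded_mult_ell1_summable assms)+
  also have "\<dots> \<le> (\<Sum>i. B * \<bar>x i\<bar>)"
    by (intro suminf_le bounded_mult_ell1_summable[OF assms] summable_mult ell1_abs_summable assms)
       (auto simp: abs_mult assms(2) mult_right_mono)
  finally show ?thesis
    using assms(1) by (simp add: norm1_def suminf_mult ell1_abs_summable)
qed

section \<open>The operator on \<open>ell1\<close>\<close>

lemma A_op_summable: "x \<in> ell1 \<Longrightarrow> summable (\<lambda>j. Amat i j * x j)"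
  by (rule bounded_mult_ell1_summable(2)[OF _ abs_Amat_le])

lemma A_op_0: "A_op x 0 = x 0 / 2 - x 1"
proof -
  have "(\<Sum>j. Amat 0 j * x j) = (\<Sum>j\<in>{0,1}. Amat 0 j * x j)"
    by (rule suminf_finite) auto
  then show ?thesis by (simp add: A_op_def)
qed

text \<open>For finitely many rows the row and column sums may be exchanged, and
  \<open>col_tail\<close> bounds each column. Coordinate 1 of \<open>x\<close> is absent because
  column 1 vanishes from row 2 on.\<close>

lemma A_op_tail:
  assumes x: "x \<in> ell1"
  shows "summable (\<lambda>i. \<bar>A_op x (i + 2)\<bar>)"
    and "tail1 (A_op x) \<le> 4523 / 10000 * \<bar>x 0\<bar> + 1 / 2 * tail1 x"
proof -
  let ?R = "4523 / 10000 * \<bar>x 0\<bar> + 1 / 2 * tail1 x"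
  have s: "summable (\<lambda>j. col_tail j * \<bar>x j\<bar>)"
    by (rule bounded_mult_ell1_summable(2)[of _ _ "1/2"])
       (use x in \<open>auto simp: col_tail_def ell1_def\<close>)
  have R: "(\<Sum>j. col_tail j * \<bar>x j\<bar>) = ?R"
    using suminf_split_initial_segment[OF s, of 2] suminf_mult[OF ell1_tail_summable[OF x], of "1/2"]
    by (simp add: col_tail_def tail1_def lessThan_nat_numeral)
  have part: "(\<Sum>i<n. \<bar>A_op x (i + 2)\<bar>) \<le> ?R" for n
  proof -
    have sj: "summable (\<lambda>j. \<bar>Amat i j * x j\<bar>)" for i
      by (rule bounded_mult_ell1_summable(1)[OF x abs_Amat_le])
    have "(\<Sum>i<n. \<bar>A_op x (i + 2)\<bar>) \<le> (\<Sum>i<n. \<Sum>j. \<bar>Amat (i + 2) j * x j\<bar>)"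
      unfolding A_op_def by (intro sum_mono summable_rabs sj)
    also have "\<dots> = (\<Sum>j. \<Sum>i<n. \<bar>Amat (i + 2) j * x j\<bar>)"
      by (rule suminf_sum[symmetric]) (rule sj)
    also have "\<dots> \<le> (\<Sum>j. col_tail j * \<bar>x j\<bar>)"
    proof (rule suminf_le[OF _ summable_sum[OF sj] s])
      fix j
      have "(\<Sum>i<n. \<bar>Amat (i + 2) j * x j\<bar>) = (\<Sum>i<n. \<bar>Amat (i + 2) j\<bar>) * \<bar>x j\<bar>"
        by (simp add: sum_distrib_right abs_mult)
      also have "\<dots> \<le> col_tail j * \<bar>x j\<bar>"
        by (intro mult_right_mono sum_abs_Amat_tail) simp
      finally show "(\<Sum>i<n. \<bar>Amat (i + 2) j * x j\<bar>) \<le> col_tail j * \<bar>x j\<bar>" .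
    qed
    finally show ?thesis unfolding R .
  qed
  show s': "summable (\<lambda>i. \<bar>A_op x (i + 2)\<bar>)"
    by (rule summableI_nonneg_bounded[OF _ part]) simp
  show "tail1 (A_op x) \<le> ?R"
    unfolding tail1_def[of "A_op x"] by (rule suminf_le_const[OF s' part])
qed

lemma A_op_ell1: "x \<in> ell1 \<Longrightarrow> A_op x \<in> ell1"
  using A_op_tail(1)[of x] summable_iff_shift[of "\<lambda>i. \<bar>A_op x i\<bar>" 2] by (simp add: ell1_def)

lemma A_op_funpow_ell1: "x \<in> ell1 \<Longrightarrow> (A_op ^^ n) x \<in> ell1"
  by (induction n) (auto intro: A_op_ell1)

lemma A_op_add_scale:
  assumes "x \<in> ell1" "y \<in> ell1"
  shows "A_op (\<lambda>i. x i + c * y i) = (\<lambda>i. A_op x i + c * A_op y i)"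
proof
  fix i
  have "(\<lambda>j. Amat i j * x j + c * (Amat i j * y j)) sums (A_op x i + c * A_op y i)"
    unfolding A_op_def
    by (intro sums_add sums_mult summable_sums A_op_summable assms)
  then show "A_op (\<lambda>i. x i + c * y i) i = A_op x i + c * A_op y i"
    unfolding A_op_def by (simp add: sums_iff algebra_simps)
qed

lemma A_op_funpow_add_eigen:
  assumes "x \<in> ell1" "v \<in> ell1" "A_op v = (\<lambda>i. l * v i)"
  shows "(A_op ^^ n) (\<lambda>i. x i + c * v i) = (\<lambda>i. (A_op ^^ n) x i + c * l ^ n * v i)"
proof (induction n)
  case (Suc n)
  show ?case
    using A_op_add_scale[OF A_op_funpow_ell1[OF assms(1), of n] assms(2), of "c * l ^ n"]
    by (simp add: Suc assms(3) mult.assoc mult.left_commute)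
qed simp

section \<open>Left eigenvectors under the pairing\<close>

lemma null_comparison:
  fixes f :: "'a \<Rightarrow> real"
  assumes "eventually (\<lambda>x. \<bar>f x\<bar> \<le> g x) F" "(g \<longlongrightarrow> 0) F"
  shows "(f \<longlongrightarrow> 0) F"
  by (rule tendsto_0_le[OF assms(2), of _ 1]) (use assms(1) in \<open>auto elim!: eventually_mono\<close>)

text \<open>Associativity of \<open>w\<close>, the matrix and \<open>x\<close> is an exchange of
  infinite sums. With only the rows below \<open>I\<close>, column \<open>j\<close> is already
  complete for \<open>1 \<le> j < I\<close>; column 0 converges by hypothesis, and the columns from
  \<open>I\<close> on are weighted by a vanishing tail of \<open>x\<close>.\<close>

lemma pairing_A_op:
  assumes x: "x \<in> ell1" and w: "\<And>i. \<bar>w i\<bar> \<le> B"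
    and left: "\<And>j. (\<lambda>i. w i * Amat i j) sums (l * w j)"
  shows "pairing w (A_op x) = l * pairing w x"
proof -
  have B: "0 \<le> B" using w[of 0] by linarith
  define p where "p I j = (\<Sum>i<I. w i * Amat i j)" for I j
  have p_eq: "p I j = l * w j" if "1 \<le> j" "j < I" for I j
  proof -
    have "(\<lambda>i. w i * Amat i j) sums p I j"
      unfolding p_def by (rule sums_finite) (use that in \<open>auto simp: Amat_lower_zero\<close>)
    then show ?thesis using left sums_unique2 by blast
  qed
  define K where "K = 3 * B + \<bar>l\<bar> * B"
  have bound: "\<bar>p I j - l * w j\<bar> \<le> K" for I j
  proof -
    have "\<bar>p I j\<bar> \<le> 3 * B"
      unfolding p_def by (rule abs_sum_mult_le[OF w sum_abs_Amat_col_le B])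
    moreover have "\<bar>l * w j\<bar> \<le> \<bar>l\<bar> * B"
      unfolding abs_mult by (rule mult_left_mono[OF w]) simp
    ultimately show ?thesis unfolding K_def by linarith
  qed
  have wx: "summable (\<lambda>j. w j * x j)"
    by (rule bounded_mult_ell1_summable(2)[OF x w])
  have diff: "(\<Sum>i<I. w i * A_op x i) - l * pairing w x = (\<Sum>j. (p I j - l * w j) * x j)" for I
  proof -
    have "(\<lambda>j. (\<Sum>i<I. w i * (Amat i j * x j)) - l * (w j * x j))
        sums ((\<Sum>i<I. w i * A_op x i) - l * pairing w x)"
      unfolding A_op_def pairing_def
      by (intro sums_diff sums_sum sums_mult summable_sums A_op_summable x wx)
    then show ?thesis
      by (simp add: sums_iff p_def sum_distrib_right left_diff_distrib mult.assoc)
  qed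
  have est: "\<bar>(\<Sum>i<I. w i * A_op x i) - l * pairing w x\<bar>
      \<le> \<bar>p I 0 - l * w 0\<bar> * \<bar>x 0\<bar> + K * (norm1 x - (\<Sum>j<I. \<bar>x j\<bar>))" if I: "1 \<le> I" for I
  proof -
    let ?f = "\<lambda>j. (p I j - l * w j) * x j"
    have "suminf ?f = (\<Sum>j. ?f (j + I)) + (\<Sum>j<I. ?f j)"
      by (rule suminf_split_initial_segment) (rule bounded_mult_ell1_summable(2)[OF x bound])
    moreover have "(\<Sum>j<I. ?f j) = (\<Sum>j\<in>{0}. ?f j)"
      by (rule sum.mono_neutral_right) (use I p_eq in auto)
    moreover have xI: "(\<lambda>j. x (j + I)) \<in> ell1"
      using summable_ignore_initial_segment[OF ell1_abs_summable[OF x], of I] by (simp add: ell1_def)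
    moreover have "\<bar>\<Sum>j. ?f (j + I)\<bar> \<le> K * norm1 (\<lambda>j. x (j + I))"
      by (rule abs_suminf_bounded_mult_le[OF xI bound])
    moreover have "norm1 (\<lambda>j. x (j + I)) = norm1 x - (\<Sum>j<I. \<bar>x j\<bar>)"
      unfolding norm1_def by (rule suminf_minus_initial_segment[OF ell1_abs_summable[OF x]])
    ultimately show ?thesis
      unfolding diff abs_mult[symmetric] by simp
  qed
  have "(\<lambda>I. p I 0) \<longlonglongrightarrow> l * w 0"
    using left[of 0] by (simp add: sums_def p_def)
  moreover have "(\<lambda>I. \<Sum>j<I. \<bar>x j\<bar>) \<longlonglongrightarrow> norm1 x"
    unfolding norm1_def by (rule summable_LIMSEQ[OF ell1_abs_summable[OF x]])
  ultimately have "(\<lambda>I. \<bar>p I 0 - l * w 0\<bar> * \<bar>x 0\<bar> + K * (norm1 x - (\<Sum>j<I. \<bar>x j\<bar>)))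
      \<longlonglongrightarrow> \<bar>l * w 0 - l * w 0\<bar> * \<bar>x 0\<bar> + K * (norm1 x - norm1 x)"
    by (intro tendsto_intros)
  then have "(\<lambda>I. (\<Sum>i<I. w i * A_op x i) - l * pairing w x) \<longlonglongrightarrow> 0"
    by (intro null_comparison[OF eventually_sequentiallyI[of 1, OF est]]) simp_all
  then have "(\<lambda>I. \<Sum>i<I. w i * A_op x i) \<longlonglongrightarrow> l * pairing w x"
    by (simp add: LIM_zero_iff)
  then show ?thesis
    unfolding pairing_def[of w "A_op x"] by (auto simp: sums_def[symmetric] sums_iff)
qed

text \<open>For the supremum \<open>M\<close> of the tail of \<open>w\<close>, the columns from 2 on
  give \<open>\<bar>l\<bar> * M \<le> (\<bar>w 1\<bar> + M) / 2\<close>, whence the factor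
  \<open>29 / 40\<close>. Column 0 then bounds \<open>w 1\<close> away from 0, and column 1 gives
  \<open>l = Amat 1 1 - 1 / w 1\<close>.\<close>

lemma left_eigenvector_bounds:
  assumes w: "\<And>i. \<bar>w i\<bar> \<le> B" and w0: "w 0 = 1"
    and left: "\<And>j. (\<lambda>i. w i * Amat i j) sums (l * w j)"
    and l: "Amat 1 1 \<le> \<bar>l\<bar>"
  shows "Amat 1 1 \<le> l" "w 1 < 0" "- 53 / 100 \<le> 1 / w 1" "\<And>i. \<bar>w (i + 2)\<bar> \<le> 29 / 40 * \<bar>w 1\<bar>"
proof -
  note A11 = Amat_1_1_bounds
  define M where "M = (SUP i. \<bar>w (i + 2)\<bar>)"
  have M: "\<bar>w (i + 2)\<bar> \<le> M" for i
    unfolding M_def by (rule cSUP_upper) (auto intro!: bdd_aboveI[of _ B] w)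
  have M0: "0 \<le> M" using M[of 0] by linarith
  define t where "t j = (\<Sum>i. w (i + 2) * Amat (i + 2) j)" for j
  have t: "\<bar>t j\<bar> \<le> col_tail j * M" for j
    unfolding t_def by (rule bounded_mult_suminf[OF M sum_abs_Amat_tail])
  have eq: "l * w j = Amat 0 j + w 1 * Amat 1 j + t j" for j
    using suminf_split_initial_segment[OF sums_summable[OF left[of j]], of 2] sums_unique[OF left[of j]]
    by (simp add: t_def w0 lessThan_nat_numeral)
  have eq1: "l * w 1 = - 1 + w 1 * Amat 1 1"
    using eq[of 1] t[of 1] by (simp add: col_tail_def)
  have labs: "\<bar>l\<bar> \<ge> 149 / 125" using l A11 by linarith
  have wi: "\<bar>l\<bar> * \<bar>w (i + 2)\<bar> \<le> 1 / 2 * \<bar>w 1\<bar> + 1 / 2 * M" for i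
  proof -
    have "\<bar>w 1 * Amat 1 (i + 2)\<bar> \<le> \<bar>w 1\<bar> * (1 / 2)"
      unfolding abs_mult by (intro mult_left_mono abs_Amat_1_le) auto
    then show ?thesis
      using eq[of "i + 2"] t[of "i + 2"] by (simp add: col_tail_def abs_mult[symmetric])
  qed
  have "M \<le> (1 / 2 * \<bar>w 1\<bar> + 1 / 2 * M) / \<bar>l\<bar>"
    unfolding M_def
    by (rule cSUP_least) (use wi labs in \<open>auto simp: field_simps M_def\<close>)
  then have "\<bar>l\<bar> * M \<le> 1 / 2 * \<bar>w 1\<bar> + 1 / 2 * M"
    using labs by (simp add: field_simps)
  moreover have "149 / 125 * M \<le> \<bar>l\<bar> * M"
    by (rule mult_right_mono[OF labs M0])
  ultimately have M1: "M \<le> 29 / 40 * \<bar>w 1\<bar>" by linarith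
  then show "\<And>i. \<bar>w (i + 2)\<bar> \<le> 29 / 40 * \<bar>w 1\<bar>"
    using M order_trans by blast
  have "\<bar>w 1 * Amat 1 0\<bar> \<le> \<bar>w 1\<bar> * (9 / 250)"
    unfolding abs_mult using Amat_1_0_bounds by (intro mult_left_mono) auto
  then have "\<bar>l\<bar> \<le> 1 / 2 + \<bar>w 1\<bar> * (9 / 250) + 4523 / 10000 * M"
    using eq[of 0] t[of 0] by (simp add: w0 col_tail_def)
  \<comment> \<open>Here \<open>\<bar>l\<bar> - 1 / 2\<close> is at least 0.692 and the coefficient
    of \<open>\<bar>w 1\<bar>\<close> is below 0.364; the quotient is below
    \<open>53 / 100\<close>.\<close>
  then have w1: "1 \<le> 53 / 100 * \<bar>w 1\<bar>"
    using M1 labs by linarith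
  then have w1n: "w 1 \<noteq> 0" by auto
  have w1i: "\<bar>1 / w 1\<bar> \<le> 53 / 100"
    using w1 w1n by (simp add: field_simps)
  have l_eq: "l = Amat 1 1 - 1 / w 1"
    using eq1 w1n by (simp add: field_simps)
  \<comment> \<open>The term \<open>1 / w 1\<close> is too small to change the sign of
    \<open>l\<close>. The hypothesis on \<open>\<bar>l\<bar>\<close> thus holds for \<open>l\<close>
    itself and forces \<open>1 / w 1 \<le> 0\<close>.\<close>
  then have "0 < l" using w1i A11 by linarith
  then show "Amat 1 1 \<le> l" using l by simp
  then have "1 / w 1 \<le> 0" using l_eq by linarith
  then show "w 1 < 0" using w1n by (simp add: divide_le_0_iff)
  show "- 53 / 100 \<le> 1 / w 1" using w1i by linarith
qed

section \<open>Growth on the kernel of a left eigenvector\<close>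

definition kernel_norm :: "(nat \<Rightarrow> real) \<Rightarrow> real" where
  "kernel_norm x = 4 / 5 * \<bar>x 0\<bar> + tail1 x"

lemma pairing_split:
  assumes "x \<in> ell1" "\<And>i. \<bar>w i\<bar> \<le> B" "\<And>i. \<bar>w (i + 2)\<bar> \<le> C"
  obtains s where "pairing w x = w 0 * x 0 + w 1 * x 1 + s" "\<bar>s\<bar> \<le> C * tail1 x"
proof
  let ?s = "\<Sum>i. w (i + 2) * x (i + 2)"
  show "pairing w x = w 0 * x 0 + w 1 * x 1 + ?s"
    unfolding pairing_def
    using suminf_split_initial_segment[OF bounded_mult_ell1_summable(2)[of x w B, OF assms(1,2)], of 2]
    by (simp add: lessThan_nat_numeral)
  show "\<bar>?s\<bar> \<le> C * tail1 x"
    using abs_suminf_bounded_mult_le[of "\<lambda>i. x (i + 2)" "\<lambda>i. w (i + 2)" C]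
      ell1_tail_summable[OF assms(1)] assms(3)
    by (simp add: tail1_def norm1_def ell1_def)
qed

text \<open>On the kernel, coordinate 1 is determined by the others, so \<open>kernel_norm\<close>
  may omit it and still control \<open>norm1\<close>. The factor \<open>11 / 10\<close> exceeds 1;
  what counts is that it is below \<open>149 / 125\<close>, a lower bound for the
  eigenvalue.\<close>

lemma kernel_contraction:
  assumes x: "x \<in> ell1" and w: "\<And>i. \<bar>w i\<bar> \<le> B" and w0: "w 0 = 1" and w1: "w 1 < 0"
    and w1i: "- 53 / 100 \<le> 1 / w 1" and wi: "\<And>i. \<bar>w (i + 2)\<bar> \<le> 29 / 40 * \<bar>w 1\<bar>"
    and ker: "pairing w x = 0"
  shows "kernel_norm (A_op x) \<le> 11 / 10 * kernel_norm x" "norm1 x \<le> 2 * kernel_norm x"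
proof -
  obtain s where s: "pairing w x = w 0 * x 0 + w 1 * x 1 + s" "\<bar>s\<bar> \<le> 29 / 40 * \<bar>w 1\<bar> * tail1 x"
    using pairing_split[of x w B "29 / 40 * \<bar>w 1\<bar>", OF x w wi] by blast
  define r where "r = 1 / w 1"
  have r: "- 53 / 100 \<le> r" "r \<le> 0" using w1 w1i by (auto simp: r_def)
  have x1: "x 1 = - (r * x 0) - s / w 1"
  proof -
    have "w 1 * x 1 = - x 0 - s"
      using s(1) ker w0 by simp
    then have "x 1 = (- x 0 - s) / w 1"
      using w1 by (simp add: eq_divide_eq mult.commute)
    then show ?thesis
      by (simp add: r_def diff_divide_distrib)
  qed
  have sw: "\<bar>s / w 1\<bar> \<le> 29 / 40 * tail1 x"
    using s(2) w1 by (simp add: field_simps)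
  have "\<bar>r * x 0\<bar> \<le> 53 / 100 * \<bar>x 0\<bar>"
    unfolding abs_mult using r by (intro mult_right_mono) auto
  then have "\<bar>x 1\<bar> \<le> 53 / 100 * \<bar>x 0\<bar> + 29 / 40 * tail1 x"
    unfolding x1 using sw by linarith
  then show "norm1 x \<le> 2 * kernel_norm x"
    using tail1_nonneg[OF x] by (simp add: norm1_eq[OF x] kernel_norm_def)
  have "A_op x 0 = (1 / 2 + r) * x 0 + s / w 1"
    unfolding A_op_0 x1 by (simp add: algebra_simps)
  \<comment> \<open>The sign of \<open>w 1\<close> enters here: \<open>r\<close> lies between
    \<open>- 53 / 100\<close> and 0, so it cannot enlarge the coefficient
    \<open>1 / 2\<close>.\<close>
  moreover have "\<bar>(1 / 2 + r) * x 0\<bar> \<le> 1 / 2 * \<bar>x 0\<bar>"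
    unfolding abs_mult by (rule mult_right_mono; use r in linarith)
  ultimately have "\<bar>A_op x 0\<bar> \<le> 1 / 2 * \<bar>x 0\<bar> + 29 / 40 * tail1 x"
    using sw by linarith
  \<comment> \<open>The weight \<open>4 / 5\<close> balances the coefficients: 0.8523 against 0.88
    for \<open>x 0\<close>, 1.08 against 1.1 for the tail. Weight 1 would give 1.225 for the tail,
    more than \<open>149 / 125\<close>.\<close>
  then show "kernel_norm (A_op x) \<le> 11 / 10 * kernel_norm x"
    using A_op_tail(2)[OF x] tail1_nonneg[OF x] unfolding kernel_norm_def distrib_left by linarith
qed

text \<open>The left eigenvector equation keeps the kernel invariant, so the one-step estimate
  iterates; \<open>norm1\<close> enters only at the end.\<close>

lemma norm1_A_op_funpow_kernel:
  assumes x: "x \<in> ell1" and w: "\<And>i. \<bar>w i\<bar> \<le> B" and w0: "w 0 = 1" and w1: "w 1 < 0"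
    and w1i: "- 53 / 100 \<le> 1 / w 1" and wi: "\<And>i. \<bar>w (i + 2)\<bar> \<le> 29 / 40 * \<bar>w 1\<bar>"
    and left: "\<And>j. (\<lambda>i. w i * Amat i j) sums (l * w j)"
    and ker: "pairing w x = 0"
  shows "norm1 ((A_op ^^ n) x) \<le> 2 * kernel_norm x * (11 / 10) ^ n"
proof -
  note contraction = kernel_contraction[OF _ w w0 w1 w1i wi]
  have "pairing w ((A_op ^^ n) x) = 0 \<and> kernel_norm ((A_op ^^ n) x) \<le> (11 / 10) ^ n * kernel_norm x"
  proof (induction n)
    case (Suc n)
    let ?y = "(A_op ^^ n) x"
    have y: "?y \<in> ell1" by (rule A_op_funpow_ell1[OF x])
    have "kernel_norm (A_op ?y) \<le> 11 / 10 * kernel_norm ?y"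
      by (rule contraction(1)[OF y]) (use Suc in auto)
    also have "\<dots> \<le> 11 / 10 * ((11 / 10) ^ n * kernel_norm x)"
      using Suc by (intro mult_left_mono) auto
    finally show ?case
      using pairing_A_op[OF y w left] Suc by simp
  qed (simp add: ker)
  then show ?thesis
    using contraction(2)[OF A_op_funpow_ell1[OF x, of n]] by (simp add: mult.commute)
qed

section \<open>Limits of the truncations\<close>

lemma abs_le_norm_inf: "x \<in> ell_inf \<Longrightarrow> \<bar>x i\<bar> \<le> norm_inf x"
  unfolding ell_inf_def norm_inf_def by (auto intro: cSUP_upper)

lemma ell_inf_diff:
  assumes "x \<in> ell_inf" "y \<in> ell_inf"
  shows "(\<lambda>i. x i - y i) \<in> ell_inf"
proof -
  have "\<bar>x i - y i\<bar> \<le> norm_inf x + norm_inf y" for i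
    using abs_le_norm_inf[OF assms(1), of i] abs_le_norm_inf[OF assms(2), of i] by linarith
  then show ?thesis by (auto simp: ell_inf_def intro!: bdd_aboveI)
qed

text \<open>Applied to the columns of the matrix it carries the left eigenvector equations to the
  limit; applied to unit vectors it gives coordinatewise convergence.\<close>

lemma tendsto_ell_inf_bounded_mult_suminf:
  assumes X: "tendsto_ell_inf X w" and a: "\<And>n. (\<Sum>i<n. \<bar>a i\<bar>) \<le> K"
  shows "summable (\<lambda>i. w i * a i)" and "(\<lambda>n. \<Sum>i. X n i * a i) \<longlonglongrightarrow> (\<Sum>i. w i * a i)"
proof -
  have w: "w \<in> ell_inf" and ev: "\<forall>\<^sub>F n in sequentially. X n \<in> ell_inf"
    and lim: "(\<lambda>n. norm_inf (\<lambda>i. X n i - w i)) \<longlonglongrightarrow> 0"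
    using X by (auto simp: tendsto_ell_inf_def)
  have summ: "summable (\<lambda>i. y i * a i)" if "y \<in> ell_inf" for y
    using bounded_mult_suminf(1)[of y, OF abs_le_norm_inf[OF that] a] by (rule summable_rabs_cancel)
  show "summable (\<lambda>i. w i * a i)" by (rule summ[OF w])
  have "\<forall>\<^sub>F n in sequentially. \<bar>(\<Sum>i. X n i * a i) - (\<Sum>i. w i * a i)\<bar>
      \<le> K * norm_inf (\<lambda>i. X n i - w i)"
    using ev
  proof eventually_elim
    case (elim n)
    have "(\<Sum>i. X n i * a i) - (\<Sum>i. w i * a i) = (\<Sum>i. (X n i - w i) * a i)"
      using suminf_diff[OF summ[OF elim] summ[OF w]] by (simp add: left_diff_distrib)
    then show ?case
      using bounded_mult_suminf(2)[of "\<lambda>i. X n i - w i", OF abs_le_norm_inf[OF ell_inf_diff[OF elim w]] a]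
      by simp
  qed
  moreover have "(\<lambda>n. K * norm_inf (\<lambda>i. X n i - w i)) \<longlonglongrightarrow> 0"
    using tendsto_mult_right_zero[OF lim] by simp
  ultimately have "(\<lambda>n. (\<Sum>i. X n i * a i) - (\<Sum>i. w i * a i)) \<longlonglongrightarrow> 0"
    by (rule null_comparison)
  then show "(\<lambda>n. \<Sum>i. X n i * a i) \<longlonglongrightarrow> (\<Sum>i. w i * a i)"
    by (rule LIM_zero_cancel)
qed

lemma tendsto_ell_inf_pointwise:
  assumes "tendsto_ell_inf X w"
  shows "(\<lambda>n. X n j) \<longlonglongrightarrow> w j"
proof -
  have "(\<Sum>i<n. \<bar>if i = j then 1 else 0 :: real\<bar>) \<le> 1" for n
    by (simp add: if_distrib[of abs] sum.delta cong: if_cong)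
  from tendsto_ell_inf_bounded_mult_suminf(2)[OF assms this]
  show ?thesis
    using suminf_finite[of "{j}" "\<lambda>i. X n i * (if i = j then 1 else 0)" for n]
      suminf_finite[of "{j}" "\<lambda>i. w i * (if i = j then 1 else 0)"]
    by simp
qed

text \<open>The dual form, applied to the rows of the matrix for the right eigenvector
  equations.\<close>

lemma tendsto_ell1_bounded_mult_suminf:
  assumes X: "tendsto_ell1 X v" and a: "\<And>i. \<bar>a i\<bar> \<le> B"
  shows "(\<lambda>n. \<Sum>i. a i * X n i) \<longlonglongrightarrow> (\<Sum>i. a i * v i)"
proof -
  have v: "v \<in> ell1" and ev: "\<forall>\<^sub>F n in sequentially. X n \<in> ell1"
    and lim: "(\<lambda>n. norm1 (\<lambda>i. X n i - v i)) \<longlonglongrightarrow> 0"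
    using X by (auto simp: tendsto_ell1_def)
  note summ = bounded_mult_ell1_summable(2)[of _ a, OF _ a]
  have "\<forall>\<^sub>F n in sequentially. \<bar>(\<Sum>i. a i * X n i) - (\<Sum>i. a i * v i)\<bar>
      \<le> B * norm1 (\<lambda>i. X n i - v i)"
    using ev
  proof eventually_elim
    case (elim n)
    have "(\<Sum>i. a i * X n i) - (\<Sum>i. a i * v i) = (\<Sum>i. a i * (X n i - v i))"
      using suminf_diff[OF summ[OF elim] summ[OF v]] by (simp add: right_diff_distrib)
    then show ?case
      using abs_suminf_bounded_mult_le[of "\<lambda>i. X n i - v i" a, OF ell1_diff[OF elim v] a]
      by simp
  qed
  moreover have "(\<lambda>n. B * norm1 (\<lambda>i. X n i - v i)) \<longlonglongrightarrow> 0"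
    using tendsto_mult_right_zero[OF lim] by simp
  ultimately have "(\<lambda>n. (\<Sum>i. a i * X n i) - (\<Sum>i. a i * v i)) \<longlonglongrightarrow> 0"
    by (rule null_comparison)
  then show ?thesis by (rule LIM_zero_cancel)
qed

lemma tendsto_ell1_pointwise:
  assumes "tendsto_ell1 X v"
  shows "(\<lambda>n. X n j) \<longlonglongrightarrow> v j"
proof -
  have "\<bar>if i = j then 1 else 0 :: real\<bar> \<le> 1" for i
    by simp
  note lim = tendsto_ell1_bounded_mult_suminf[of X v "\<lambda>i. if i = j then 1 else 0", OF assms this]
  show ?thesis
    using lim suminf_finite[of "{j}" "\<lambda>i. (if i = j then 1 else 0) * X n i" for n]
      suminf_finite[of "{j}" "\<lambda>i. (if i = j then 1 else 0) * v i"]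
    by simp
qed

section \<open>Continuity of the normalisation\<close>

lemma abs_norm1_diff_le:
  assumes "x \<in> ell1" "y \<in> ell1"
  shows "\<bar>norm1 x - norm1 y\<bar> \<le> norm1 (\<lambda>i. x i - y i)"
proof -
  have "norm1 x \<le> norm1 (\<lambda>i. x i - y i) + norm1 y"
    using ell1_add(2)[OF ell1_diff[OF assms] assms(2)] by simp
  moreover have "norm1 y \<le> norm1 (\<lambda>i. - 1 * (x i - y i)) + norm1 x"
    using ell1_add(2)[OF ell1_scale(1)[OF ell1_diff[OF assms], of "- 1"] assms(1)] by simp
  ultimately show ?thesis
    using ell1_scale(2)[OF ell1_diff[OF assms], of "- 1"] by simp
qed

lemma tendsto_ell1_normalise:
  assumes X: "tendsto_ell1 X L" and L: "norm1 L \<noteq> 0"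
  shows "tendsto_ell1 (\<lambda>n i. X n i / norm1 (X n)) (\<lambda>i. L i / norm1 L)"
proof -
  have L1: "L \<in> ell1" and ev: "\<forall>\<^sub>F n in sequentially. X n \<in> ell1"
    and lim: "(\<lambda>n. norm1 (\<lambda>i. X n i - L i)) \<longlonglongrightarrow> 0"
    using X by (auto simp: tendsto_ell1_def)
  have scale: "(\<lambda>i. x i / c) \<in> ell1" if "x \<in> ell1" for x c
    using ell1_scale(1)[OF that, of "inverse c"] by (simp add: field_simps)
  have "\<forall>\<^sub>F n in sequentially. \<bar>norm1 (X n) - norm1 L\<bar> \<le> norm1 (\<lambda>i. X n i - L i)"
    using ev by eventually_elim (simp add: abs_norm1_diff_le L1)
  then have "(\<lambda>n. norm1 (X n) - norm1 L) \<longlonglongrightarrow> 0"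
    using lim by (rule null_comparison)
  then have lim_norm: "(\<lambda>n. norm1 (X n)) \<longlonglongrightarrow> norm1 L"
    by (rule LIM_zero_cancel)
  have "\<forall>\<^sub>F n in sequentially. \<bar>norm1 (\<lambda>i. X n i / norm1 (X n) - L i / norm1 L)\<bar>
      \<le> \<bar>inverse (norm1 (X n))\<bar> * norm1 (\<lambda>i. X n i - L i)
        + \<bar>inverse (norm1 (X n)) - inverse (norm1 L)\<bar> * norm1 L"
    using ev
  proof eventually_elim
    case (elim n)
    let ?c = "inverse (norm1 (X n))" and ?d = "inverse (norm1 (X n)) - inverse (norm1 L)"
    have D: "(\<lambda>i. X n i - L i) \<in> ell1" by (rule ell1_diff[OF elim L1])
    \<comment> \<open>The first coefficient stays bounded and the second tends to 0. The identity
      also covers \<open>norm1 (X n) = 0\<close>, where quotient and inverse are both 0 by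
      convention.\<close>
    have eq: "(\<lambda>i. X n i / norm1 (X n) - L i / norm1 L) = (\<lambda>i. ?c * (X n i - L i) + ?d * L i)"
      by (auto simp: divide_inverse algebra_simps)
    have "norm1 (\<lambda>i. ?c * (X n i - L i) + ?d * L i) \<le> \<bar>?c\<bar> * norm1 (\<lambda>i. X n i - L i) + \<bar>?d\<bar> * norm1 L"
      using ell1_add(2)[OF ell1_scale(1)[OF D, of ?c] ell1_scale(1)[OF L1, of ?d]]
      by (simp only: ell1_scale(2)[OF D] ell1_scale(2)[OF L1])
    then show ?case
      unfolding eq[symmetric] using norm1_nonneg[OF ell1_diff[OF scale[OF elim] scale[OF L1]]] by simp
  qed
  moreover have "(\<lambda>n. \<bar>inverse (norm1 (X n))\<bar> * norm1 (\<lambda>i. X n i - L i)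
        + \<bar>inverse (norm1 (X n)) - inverse (norm1 L)\<bar> * norm1 L)
      \<longlonglongrightarrow> \<bar>inverse (norm1 L)\<bar> * 0 + \<bar>inverse (norm1 L) - inverse (norm1 L)\<bar> * norm1 L"
    by (intro tendsto_intros lim_norm lim L)
  then have "(\<lambda>n. \<bar>inverse (norm1 (X n))\<bar> * norm1 (\<lambda>i. X n i - L i)
        + \<bar>inverse (norm1 (X n)) - inverse (norm1 L)\<bar> * norm1 L) \<longlonglongrightarrow> 0"
    by simp
  ultimately have "(\<lambda>n. norm1 (\<lambda>i. X n i / norm1 (X n) - L i / norm1 L)) \<longlonglongrightarrow> 0"
    by (rule null_comparison)
  moreover have "\<forall>\<^sub>F n in sequentially. (\<lambda>i. X n i / norm1 (X n)) \<in> ell1"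
    using ev by eventually_elim (rule scale)
  ultimately show ?thesis
    by (simp add: tendsto_ell1_def scale L1)
qed

section \<open>Eigenvector equations in coordinates and in the limit\<close>

lemma eigenvector_A_truncD:
  assumes "eigenvector (A_trunc n) (vec (n + 1) y) l" "i \<le> n"
  shows "(\<Sum>j<n+1. Amat i j * y j) = l * y i"
proof -
  have "(A_trunc n *\<^sub>v vec (n + 1) y) $ i = (l \<cdot>\<^sub>v vec (n + 1) y) $ i"
    using assms(1) by (simp only: eigenvector_def)
  then show ?thesis
    using assms(2) by (simp add: A_trunc_def scalar_prod_def atLeast0LessThan)
qed

lemma eigenvector_transpose_A_truncD:
  assumes "eigenvector (transpose_mat (A_trunc n)) (vec (n + 1) y) l" "j \<le> n"
  shows "(\<Sum>i<n+1. y i * Amat i j) = l * y j"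
proof -
  have "((A_trunc n)\<^sup>T *\<^sub>v vec (n + 1) y) $ j = (l \<cdot>\<^sub>v vec (n + 1) y) $ j"
    using assms(1) by (simp only: eigenvector_def)
  then show ?thesis
    using assms(2) by (simp add: A_trunc_def scalar_prod_def atLeast0LessThan mult.commute)
qed

theorem theorem5p8:
  fixes lam_seq :: "nat \<Rightarrow> real" and lam :: real
    and v_seq w_seq :: "nat \<Rightarrow> nat \<Rightarrow> real"
    and v w u :: "nat \<Rightarrow> real"
    and \<zeta> :: real
  assumes lam_seq: "\<And>n. 7 \<le> n \<Longrightarrow> simple_dominant_eigenvalue (A_trunc n) (lam_seq n)"
    and v_eigen: "\<And>n. 7 \<le> n \<Longrightarrow> eigenvector (A_trunc n) (vec (n + 1) (v_seq n)) (lam_seq n)"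
    and v_normalised: "\<And>n. 7 \<le> n \<Longrightarrow> v_seq n 0 = 1"
    and v_extended: "\<And>n i. 7 \<le> n \<Longrightarrow> n < i \<Longrightarrow> v_seq n i = 0"
    and w_eigen: "\<And>n. 7 \<le> n \<Longrightarrow>
          eigenvector (transpose_mat (A_trunc n)) (vec (n + 1) (w_seq n)) (lam_seq n)"
    and w_normalised: "\<And>n. 7 \<le> n \<Longrightarrow> w_seq n 0 = 1"
    and w_extended: "\<And>n i. 7 \<le> n \<Longrightarrow> n < i \<Longrightarrow> w_seq n i = 0"
    and lam: "lam_seq \<longlonglongrightarrow> lam"
    and v: "tendsto_ell1 v_seq v"
    and w: "tendsto_ell_inf w_seq w"
    and zeta: "\<zeta> = pairing w v"
    and u: "u \<in> ell1"
    and wu: "pairing w u \<noteq> 0"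
  shows "lam \<noteq> 0 \<and> \<zeta> \<noteq> 0 \<and>
    tendsto_ell1 (\<lambda>n i. inverse lam ^ n * (A_op ^^ n) u i)
                 (\<lambda>i. pairing w u * v i / \<zeta>) \<and>
    tendsto_ell1 (\<lambda>n i. (A_op ^^ n) u i / norm1 ((A_op ^^ n) u))
                 (\<lambda>i. pairing w u * v i / norm1 (\<lambda>j. pairing w u * v j))"
proof -
  have v1: "v \<in> ell1" and w_inf: "w \<in> ell_inf"
    using v w by (auto simp: tendsto_ell1_def tendsto_ell_inf_def)
  note wB = abs_le_norm_inf[OF w_inf]
  have v0: "v 0 = 1"
    by (rule LIMSEQ_unique[OF tendsto_ell1_pointwise[OF v]])
       (auto intro!: tendsto_eventually eventually_sequentiallyI[of 7] v_normalised)
  have w0: "w 0 = 1"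
    by (rule LIMSEQ_unique[OF tendsto_ell_inf_pointwise[OF w]])
       (auto intro!: tendsto_eventually eventually_sequentiallyI[of 7] w_normalised)

  \<comment> \<open>For fixed \<open>j\<close> the truncated equation is available once
    \<open>n \<ge> max 7 j\<close>; extension by zeros turns its finite sum into a series, and both
    sides converge.\<close>
  have left: "(\<lambda>i. w i * Amat i j) sums (lam * w j)" for j
  proof -
    note lim = tendsto_ell_inf_bounded_mult_suminf[OF w sum_abs_Amat_col_le[where j = j]]
    have "(\<Sum>i. w_seq n i * Amat i j) = lam_seq n * w_seq n j" if "max 7 j \<le> n" for n
    proof -
      have "(\<Sum>i. w_seq n i * Amat i j) = (\<Sum>i<n+1. w_seq n i * Amat i j)"
        by (rule suminf_finite) (use that w_extended in auto)
      then show ?thesis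
        using eigenvector_transpose_A_truncD[OF w_eigen, of n j] that by simp
    qed
    then have "\<forall>\<^sub>F n in sequentially. (\<Sum>i. w_seq n i * Amat i j) = lam_seq n * w_seq n j"
      by (rule eventually_sequentiallyI)
    with lim(2) have "(\<lambda>n. lam_seq n * w_seq n j) \<longlonglongrightarrow> (\<Sum>i. w i * Amat i j)"
      by (rule Lim_transform_eventually)
    moreover have "(\<lambda>n. lam_seq n * w_seq n j) \<longlonglongrightarrow> lam * w j"
      by (intro tendsto_mult lam tendsto_ell_inf_pointwise w)
    ultimately show ?thesis
      using lim(1) LIMSEQ_unique sums_iff by blast
  qed

  have right: "A_op v = (\<lambda>i. lam * v i)"
  proof
    fix i
    note lim = tendsto_ell1_bounded_mult_suminf[OF v abs_Amat_le[of i]]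
    have "(\<Sum>j. Amat i j * v_seq n j) = lam_seq n * v_seq n i" if "max 7 i \<le> n" for n
    proof -
      have "(\<Sum>j. Amat i j * v_seq n j) = (\<Sum>j<n+1. Amat i j * v_seq n j)"
        by (rule suminf_finite) (use that v_extended in auto)
      then show ?thesis
        using eigenvector_A_truncD[OF v_eigen, of n i] that by simp
    qed
    then have "\<forall>\<^sub>F n in sequentially. (\<Sum>j. Amat i j * v_seq n j) = lam_seq n * v_seq n i"
      by (rule eventually_sequentiallyI)
    with lim have "(\<lambda>n. lam_seq n * v_seq n i) \<longlonglongrightarrow> (\<Sum>j. Amat i j * v j)"
      by (rule Lim_transform_eventually)
    moreover have "(\<lambda>n. lam_seq n * v_seq n i) \<longlonglongrightarrow> lam * v i"
      by (intro tendsto_mult lam tendsto_ell1_pointwise v)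
    ultimately show "A_op v i = lam * v i"
      unfolding A_op_def by (rule LIMSEQ_unique)
  qed

  have "Amat 1 1 \<le> \<bar>lam\<bar>"
  proof (rule LIMSEQ_le_const[OF tendsto_rabs[OF lam]], intro exI allI impI)
    show "Amat 1 1 \<le> \<bar>lam_seq n\<bar>" if "7 \<le> n" for n
      using that by (intro dominant_eigenvalue_ge[of n] lam_seq) auto
  qed
  note bounds = left_eigenvector_bounds[OF wB w0 left this]
  have lam_ge: "149 / 125 \<le> lam"
    using bounds(1) Amat_1_1_bounds by linarith

  \<comment> \<open>Both \<open>w 1\<close> and \<open>v 1 = 1 / 2 - lam\<close> are negative, with
    product at least \<open>0.692 * \<bar>w 1\<bar>\<close>; the coordinates from 2 on contribute at
    most \<open>29 / 40 * 7 / 10 * \<bar>w 1\<bar>\<close> in absolute value.\<close>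
  have "0 < \<zeta>"
  proof -
    obtain s where s: "\<zeta> = w 0 * v 0 + w 1 * v 1 + s" "\<bar>s\<bar> \<le> 29 / 40 * \<bar>w 1\<bar> * tail1 v"
      using pairing_split[of v w, OF v1 wB bounds(4)] unfolding zeta by blast
    have "tail1 (A_op v) = lam * tail1 v"
      using suminf_mult[OF ell1_tail_summable[OF v1], of lam] lam_ge
      by (simp add: right tail1_def abs_mult)
    then have "lam * tail1 v \<le> 4523 / 10000 + 1 / 2 * tail1 v"
      using A_op_tail(2)[OF v1] v0 by simp
    moreover have "149 / 125 * tail1 v \<le> lam * tail1 v"
      by (rule mult_right_mono[OF lam_ge tail1_nonneg[OF v1]])
    ultimately have "tail1 v \<le> 7 / 10" by linarith
    then have "29 / 40 * \<bar>w 1\<bar> * tail1 v \<le> 29 / 40 * \<bar>w 1\<bar> * (7 / 10)"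
      by (intro mult_left_mono) auto
    moreover have "v 1 = 1 / 2 - lam"
      using A_op_0[of v] v0 right by simp
    then have "w 1 * v 1 = \<bar>w 1\<bar> * (lam - 1 / 2)"
      using bounds(2) by (simp add: abs_of_neg right_diff_distrib)
    moreover have "\<bar>w 1\<bar> * (173 / 250) \<le> \<bar>w 1\<bar> * (lam - 1 / 2)"
      using lam_ge by (intro mult_left_mono) auto
    moreover have "\<zeta> = 1 + w 1 * v 1 + s"
      using s(1) v0 w0 by simp
    ultimately show ?thesis
      using s(2) abs_ge_zero[of "w 1"] by linarith
  qed

  \<comment> \<open>This coefficient places \<open>u - c * v\<close> in the kernel of
    \<open>w\<close>.\<close>
  define c where "c = pairing w u / \<zeta>"
  define x where "x i = u i - c * v i" for i
  have x1: "x \<in> ell1"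
    unfolding x_def by (intro ell1_diff ell1_scale u v1)
  have "pairing w x = pairing w u - c * pairing w v"
  proof -
    have "(\<lambda>i. w i * u i - c * (w i * v i)) sums (pairing w u - c * pairing w v)"
      unfolding pairing_def
      by (intro sums_diff sums_mult summable_sums bounded_mult_ell1_summable(2)[OF _ wB] u v1)
    then show ?thesis
      by (simp add: pairing_def x_def sums_iff algebra_simps)
  qed
  then have ker: "pairing w x = 0"
    using \<open>0 < \<zeta>\<close> by (simp add: c_def zeta)
  have decomp: "(A_op ^^ n) u = (\<lambda>i. (A_op ^^ n) x i + c * lam ^ n * v i)" for n
    using A_op_funpow_add_eigen[OF x1 v1 right, of n c] by (simp add: x_def)
  define L where "L = (\<lambda>i. c * v i)"
  have L1: "L \<in> ell1" unfolding L_def by (rule ell1_scale(1)[OF v1])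
  define z where "z n i = inverse lam ^ n * (A_op ^^ n) u i" for n i
  \<comment> \<open>Scaling makes the component along \<open>v\<close> constant, so the error is
    exactly the scaled orbit of the kernel component.\<close>
  have z_diff: "(\<lambda>i. z n i - L i) = (\<lambda>i. inverse lam ^ n * (A_op ^^ n) x i)" for n
    using lam_ge by (auto simp: z_def L_def decomp field_simps)
  have est: "\<bar>norm1 (\<lambda>i. z n i - L i)\<bar> \<le> 2 * kernel_norm x * (11 / 10 / lam) ^ n" for n
  proof -
    have "norm1 (\<lambda>i. z n i - L i) = inverse lam ^ n * norm1 ((A_op ^^ n) x)"
      unfolding z_diff ell1_scale(2)[OF A_op_funpow_ell1[OF x1]] using lam_ge by simp
    moreover have "\<dots> \<le> inverse lam ^ n * (2 * kernel_norm x * (11 / 10) ^ n)"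
      using lam_ge
      by (intro mult_left_mono norm1_A_op_funpow_kernel[OF x1 wB w0 bounds(2-4) left ker]) auto
    moreover have "0 \<le> inverse lam ^ n * norm1 ((A_op ^^ n) x)"
      using lam_ge norm1_nonneg[OF A_op_funpow_ell1[OF x1]] by simp
    ultimately show ?thesis
      by (simp add: power_divide field_simps)
  qed
  \<comment> \<open>The ratio is below 1 because
    \<open>11 / 10 < 149 / 125 \<le> lam\<close>.\<close>
  have "(\<lambda>n. 2 * kernel_norm x * (11 / 10 / lam) ^ n) \<longlonglongrightarrow> 0"
    by (intro tendsto_mult_right_zero LIMSEQ_power_zero) (use lam_ge in \<open>simp add: field_simps\<close>)
  then have "(\<lambda>n. norm1 (\<lambda>i. z n i - L i)) \<longlonglongrightarrow> 0"
    by (rule null_comparison[OF eventually_sequentiallyI[of 0, OF est]])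
  then have conv: "tendsto_ell1 z L"
    unfolding tendsto_ell1_def z_def
    by (auto intro!: L1 ell1_scale A_op_funpow_ell1 u always_eventually)
  have L_eq: "L = (\<lambda>i. pairing w u * v i / \<zeta>)"
    by (simp add: L_def c_def)
  have norm_v: "norm1 v \<noteq> 0"
    using abs_le_norm1[OF v1, of 0] v0 by simp
  have "norm1 L = \<bar>c\<bar> * norm1 v"
    unfolding L_def by (rule ell1_scale(2)[OF v1])
  then have norm_L: "norm1 L \<noteq> 0"
    using wu \<open>0 < \<zeta>\<close> norm_v by (simp add: c_def)
  \<comment> \<open>Since \<open>lam\<close> is positive, the scaling factor cancels in the quotient
    without an alternating sign.\<close>
  have "norm1 (z n) = inverse lam ^ n * norm1 ((A_op ^^ n) u)" for n
    unfolding z_def ell1_scale(2)[OF A_op_funpow_ell1[OF u]] using lam_ge by simp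
  then have "(\<lambda>n i. z n i / norm1 (z n)) = (\<lambda>n i. (A_op ^^ n) u i / norm1 ((A_op ^^ n) u))"
    using lam_ge by (auto simp: z_def)
  \<comment> \<open>Since \<open>\<zeta>\<close> is positive, it cancels without affecting the sign
    of \<open>pairing w u\<close>.\<close>
  moreover have "(\<lambda>i. L i / norm1 L) = (\<lambda>i. pairing w u * v i / norm1 (\<lambda>j. pairing w u * v j))"
    using \<open>0 < \<zeta>\<close> \<open>norm1 L = \<bar>c\<bar> * norm1 v\<close>
    by (auto simp: ell1_scale(2)[OF v1] L_eq c_def)
  ultimately show ?thesis
    using lam_ge \<open>0 < \<zeta>\<close> conv tendsto_ell1_normalise[OF conv norm_L] L_eq by (simp add: z_def[abs_def])
qed

end
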